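(* Let $\varphi:D\to D$ be an analytic self-map of $D$, let $g\in H(D)$, and let $0<\beta<\infty$. Let $U_gC_\varphi$ be the operator $(U_gC_\varphi f)(z)=\int_0^{z} f(\varphi(\xi))g'(\xi)\,d\xi$. (i) If $0<\alpha<1$, then $U_gC_\varphi:\mathcal{Z}^\alpha\to\mathcal{Z}^\beta$ is a bounded operator if and only if $g'\varphi'\in H^\infty_{v_\beta}$ and $g''\in H^\infty_{v_\beta}$. (ii) If $\alpha=1$, then $U_gC_\varphi:\mathcal{Z}^\alpha\to\mathcal{Z}^\beta$ is a bounded operator if and only if $g''\in H^\infty_{v_\beta}$ and $$\sup_{n\ge 0}\log(n+2)\,\|g'\varphi'\varphi^n\|_{v_\beta}\asymp\sup_{z\in D}(1-|z|^2)^\beta\log\Big(\frac{2}{1-|\varphi(z)|^2}\Big)|g'(z)\varphi'(z)|<\infty.$$ (iii) If $1<\alpha<2$, then $U_gC_\varphi:\mathcal{Z}^\alpha\to\mathcal{Z}^\beta$ is a bounded operator if and only if $g''\in H^\infty_{v_\beta}$ and $$\sup_{n\ge 0}(n+1)^{\alpha-1}\|g'\varphi'\varphi^n\|_{v_\beta}\asymp\sup_{z\in D}\frac{(1-|z|^2)^\beta}{(1-|\varphi(z)|^2)^{\alpha-1}}|g'(z)\varphi'(z)|<\infty.$$ (iv) If $\alpha=2$, then $U_gC_\varphi:\mathcal{Z}^\alpha\to\mathcal{Z}^\beta$ is a bounded operator if and only if $$\sup_{n\ge 0}(n+1)\|g'\varphi'\varphi^n\|_{v_\beta}\asymp\sup_{z\in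 D}\frac{(1-|z|^2)^\beta}{1-|\varphi(z)|^2}|g'(z)\varphi'(z)|<\infty$$ and $$\sup_{n\ge 0}\log(n+2)\,\|g''\varphi^n\|_{v_\beta}\asymp\sup_{z\in D}(1-|z|^2)^\beta\log\Big(\frac{2}{1-|\varphi(z)|^2}\Big)|g''(z)|<\infty.$$ (v) If $\alpha>2$, then $U_gC_\varphi:\mathcal{Z}^\alpha\to\mathcal{Z}^\beta$ is a bounded operator if and only if $$\sup_{n\ge 0}(n+1)^{\alpha-1}\|g'\varphi'\varphi^n\|_{v_\beta}\asymp\sup_{z\in D}\frac{(1-|z|^2)^\beta}{(1-|\varphi(z)|^2)^{\alpha-1}}|g'(z)\varphi'(z)|<\infty$$ and $$\sup_{n\ge 0}(n+1)^{\alpha-2}\|g''\varphi^n\|_{v_\beta}\asymp\sup_{z\in D}\frac{(1-|z|^2)^\beta}{(1-|\varphi(z)|^2)^{\alpha-2}}|g''(z)|<\infty.$$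
   Context: $D=\{z\in\mathbb{C}:|z|<1\}$ and $H(D)$ is the set of analytic functions on $D$. For $0<\alpha<\infty$, the Zygmund type space $\mathcal{Z}^\alpha$ is the Banach space of $f\in H(D)$ with $\sup_{z\in D}(1-|z|^2)^\alpha|f''(z)|<\infty$, normed by $\|f\|_{\mathcal{Z}^\alpha}=|f(0)|+|f'(0)|+\sup_{z\in D}(1-|z|^2)^\alpha|f''(z)|$. For $0<\beta<\infty$, $v_\beta(z)=(1-|z|^2)^\beta$, $\|h\|_{v_\beta}=\sup_{z\in D}v_\beta(z)|h(z)|$ (possibly $+\infty$) for $h\in H(D)$, and $H^\infty_{v_\beta}=\{h\in H(D):\|h\|_{v_\beta}<\infty\}$. $\varphi^n$ denotes the $n$-th power (pointwise product) of $\varphi$, with $\varphi^0=1$. $A\asymp B$ means that there are positive constants $C_1,C_2$ with $C_1A\le B\le C_2A$ (constants not depending on $g$ or $\varphi$); a condition "$A\asymp B<\infty$" means that the two quantities are comparable and finite. *)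

theory Defs
  imports "HOL-Complex_Analysis.Complex_Analysis"
begin

text \<open>
  Elements of \<open>H(D)\<close> are represented by functions \<open>f :: complex \<Rightarrow> complex\<close> with
  \<open>f holomorphic_on unit_disc\<close>; nothing below depends on their values outside the disc.
  Suprema that may be infinite are taken in \<^typ>\<open>ennreal\<close>.
\<close>

abbreviation unit_disc :: "complex set" where
  "unit_disc \<equiv> ball 0 1"

definition disc_self_map :: "(complex \<Rightarrow> complex) \<Rightarrow> bool" where
  "disc_self_map \<phi> \<longleftrightarrow> \<phi> holomorphic_on unit_disc \<and> \<phi> ` unit_disc \<subseteq> unit_disc"

definition weighted_norm :: "real \<Rightarrow> (complex \<Rightarrow> complex) \<Rightarrow> ennreal" where
  "weighted_norm \<beta> h = (SUP z\<in>unit_disc. ennreal ((1 - (cmod z)\<^sup>2) powr \<beta> * cmod (h z)))"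

definition H_infinity :: "real \<Rightarrow> (complex \<Rightarrow> complex) set" where
  "H_infinity \<beta> = {h. h holomorphic_on unit_disc \<and> weighted_norm \<beta> h < \<infinity>}"

definition zygmund_space :: "real \<Rightarrow> (complex \<Rightarrow> complex) set" where
  "zygmund_space \<alpha> =
     {f. f holomorphic_on unit_disc \<and> weighted_norm \<alpha> (deriv (deriv f)) < \<infinity>}"

definition zygmund_norm :: "real \<Rightarrow> (complex \<Rightarrow> complex) \<Rightarrow> ennreal" where
  "zygmund_norm \<alpha> f =
     ennreal (cmod (f 0)) + ennreal (cmod (deriv f 0)) + weighted_norm \<alpha> (deriv (deriv f))"

definition UC :: "(complex \<Rightarrow> complex) \<Rightarrow> (complex \<Rightarrow> complex) \<Rightarrow>
    (complex \<Rightarrow> complex) \<Rightarrow> complex \<Rightarrow> complex" where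
  "UC g \<phi> f = (\<lambda>z. contour_integral (linepath 0 z) (\<lambda>\<xi>. f (\<phi> \<xi>) * deriv g \<xi>))"

definition bounded_zygmund_operator ::
    "real \<Rightarrow> real \<Rightarrow> ((complex \<Rightarrow> complex) \<Rightarrow> complex \<Rightarrow> complex) \<Rightarrow> bool" where
  "bounded_zygmund_operator \<alpha> \<beta> T \<longleftrightarrow>
     (\<forall>f\<in>zygmund_space \<alpha>. T f \<in> zygmund_space \<beta>) \<and>
     (\<exists>C::real. C \<ge> 0 \<and>
        (\<forall>f\<in>zygmund_space \<alpha>. zygmund_norm \<beta> (T f) \<le> ennreal C * zygmund_norm \<alpha> f))"

text \<open>
  \<open>A \<asymp> B < \<infinity>\<close> for given constants. The constants are arguments so that a statement can
  quantify them outside of the functions on which \<open>A\<close> and \<open>B\<close> depend.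
\<close>

definition comparable_finite :: "real \<Rightarrow> real \<Rightarrow> ennreal \<Rightarrow> ennreal \<Rightarrow> bool" where
  "comparable_finite C1 C2 A B \<longleftrightarrow>
     ennreal C1 * A \<le> B \<and> B \<le> ennreal C2 * A \<and> A < \<infinity> \<and> B < \<infinity>"

end

theory Submission
  imports Defs
begin

text \<open>
  Write \<open>T = U\<^sub>gC\<^sub>\<phi>\<close>, \<open>u = g'\<phi>'\<close> and \<open>w = g''\<close>. Then \<open>(Tf)'' = (f' \<circ> \<phi>) u + (f \<circ> \<phi>) w\<close>, so
  boundedness of \<open>T\<close> says that the weighted supremum of this expression is controlled by the
  Zygmund norm of \<open>f\<close>. All five cases are instances of one criterion. Let \<open>growth s x\<close> be \<open>1\<close>,
  \<open>ln (2 / x)\<close> or \<open>x powr (- s)\<close> according to whether \<open>s\<close> is negative, zero or positive: with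
  \<open>x = 1 - |z|\<^sup>2\<close> it is the size that an analytic function can attain at \<open>z\<close> when its derivative is
  of size \<open>x powr (- s - 1)\<close>. For every \<open>\<alpha> > 0\<close> the operator is bounded if and only if
  \<open>v\<^sub>\<beta> |u| growth (\<alpha> - 1) (1 - |\<phi>|\<^sup>2)\<close> and \<open>v\<^sub>\<beta> |w| growth (\<alpha> - 2) (1 - |\<phi>|\<^sup>2)\<close> are bounded on the
  disc (\<open>bounded_UC_iff_growth_bounded\<close>).

  Sufficiency: integrating the bound on \<open>f''\<close> along radii once and twice gives
  \<open>|f'| \<le> C \<parallel>f\<parallel> growth (\<alpha> - 1)\<close> and \<open>|f| \<le> C \<parallel>f\<parallel> growth (\<alpha> - 2)\<close> (\<open>zygmund_space_growth\<close>).

  Necessity: there are norm-bounded families of functions, indexed by \<open>a\<close> in the disc, for which these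
  estimates are sharp at \<open>a\<close>. Let \<open>k\<^sub>s\<close> be the analytic function obtained from \<open>growth s\<close> by replacing
  \<open>1 - |z|\<^sup>2\<close> with \<open>1 - (cnj a) z\<close>. With \<open>s = \<alpha> - 1\<close>, the function \<open>(z - a) k\<^sub>s(z)\<close> vanishes at \<open>a\<close>, where its derivative is
  \<open>growth (\<alpha> - 1) (1 - |a|\<^sup>2)\<close>; testing at \<open>a = \<phi> z\<close> isolates \<open>u\<close>. With \<open>s = \<alpha> - 2\<close>, the function \<open>k\<^sub>s\<close> takes the value
  \<open>growth (\<alpha> - 2) (1 - |a|\<^sup>2)\<close> at \<open>a\<close>, and its contribution through \<open>u\<close> is already controlled, so that it
  yields the bound on \<open>w\<close>.

  The power conditions are independent of the operator: up to constants,
  \<open>sup\<^sub>n (n + 1) powr s * r ^ n\<close> is \<open>growth s (1 - r\<^sup>2)\<close> for \<open>s > 0\<close>, and \<open>sup\<^sub>n ln (n + 2) * r ^ n\<close> is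
  \<open>growth 0 (1 - r\<^sup>2)\<close>. Putting \<open>r = |\<phi> z|\<close> and exchanging the suprema over \<open>n\<close> and \<open>z\<close> makes the two
  sides of each comparison equivalent, with constants that depend on \<open>s\<close> only. Hence each condition
  merely says that the quantities are finite.
\<close>

section \<open>The growth scale\<close>

definition growth :: "real \<Rightarrow> real \<Rightarrow> real" where
  "growth s x = (if s < 0 then 1 else if s = 0 then ln (2 / x) else x powr (- s))"

text \<open>
  The \<open>2\<close> in the logarithm keeps the scale away from zero at the centre of the disc, so additive
  constants such as \<open>|f 0|\<close> can be absorbed into multiples of \<open>growth\<close>.
\<close>

lemma growth_ge_half:
  assumes "0 < x" "x \<le> 1"
  shows "1 / 2 \<le> growth s x"
proof -
  have "1 / 2 \<le> ln (2::real)"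
    using ln2_ge_two_thirds by simp
  also have "\<dots> \<le> ln (2 / x)"
    using assms by (intro ln_mono) (auto simp: field_simps)
  finally have "1 / 2 \<le> ln (2 / x)" .
  moreover have "x powr (- s) \<ge> 1" if "s > 0"
    using powr_mono'[of "- s" 0 x] assms that by simp
  ultimately show ?thesis
    by (force simp: growth_def)
qed

lemma growth_nonneg: "0 < x \<Longrightarrow> x \<le> 1 \<Longrightarrow> 0 \<le> growth s x"
  using growth_ge_half[of x s] by linarith

text \<open>
  The second radial integration in the case \<open>\<alpha> \<le> 1\<close> starts from a bounded or logarithmic majorant.
  Replacing it by an integrable power loses nothing, because the result is bounded in any case.
\<close>

lemma growth_le_inverse_sqrt:
  assumes "s \<le> 0" "0 < x" "x \<le> 1"
  shows "growth s x \<le> 4 * x powr (- (1 / 2))"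
proof -
  have sq: "x powr (- (1 / 2)) = 1 / sqrt x"
    using assms by (simp add: powr_minus_divide powr_half_sqrt)
  have "ln (2 / x) = 2 * ln (sqrt (2 / x))"
    using assms by (simp add: ln_sqrt)
  also have "\<dots> \<le> 2 * sqrt (2 / x)"
    using assms ln_bound[of "sqrt (2 / x)"] by simp
  also have "\<dots> = 2 * sqrt 2 * (1 / sqrt x)"
    by (simp add: real_sqrt_divide)
  also have "\<dots> \<le> 4 * (1 / sqrt x)"
    using sqrt2_less_2 assms by (intro mult_right_mono) auto
  finally have "ln (2 / x) \<le> 4 * x powr (- (1 / 2))"
    by (simp add: sq)
  moreover have "1 \<le> 4 * x powr (- (1 / 2))"
    using powr_mono'[of "- (1 / 2)" 0 x] assms by simp
  ultimately show ?thesis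
    using assms(1) by (auto simp: growth_def)
qed

lemma one_minus_square_bounds:
  assumes "0 \<le> r" "r < (1::real)"
  shows "0 < 1 - r\<^sup>2" "1 - r\<^sup>2 \<le> 1" "1 - r \<le> 1 - r\<^sup>2" "1 - r\<^sup>2 \<le> 2 * (1 - r)"
proof -
  have "r * r \<le> r * 1" "0 \<le> (1 - r) * (1 - r)"
    using assms by (intro mult_left_mono) auto
  then show "0 < 1 - r\<^sup>2" "1 - r\<^sup>2 \<le> 1" "1 - r \<le> 1 - r\<^sup>2" "1 - r\<^sup>2 \<le> 2 * (1 - r)"
    using assms by (auto simp: power2_eq_square algebra_simps)
qed

lemma disc_weight_bounds:
  assumes "z \<in> unit_disc"
  shows "0 < 1 - (cmod z)\<^sup>2" "1 - (cmod z)\<^sup>2 \<le> 1"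
  using one_minus_square_bounds[of "cmod z"] assms by auto

section \<open>Radial integration\<close>

text \<open>
  An antiderivative of \<open>(1 - t) powr (- s)\<close>.
\<close>

definition integrated_weight :: "real \<Rightarrow> real \<Rightarrow> real" where
  "integrated_weight s t = (if s = 1 then - ln (1 - t) else (1 - t) powr (1 - s) / (s - 1))"

lemma integrated_weight_deriv:
  assumes "t < 1"
  shows "(integrated_weight s has_field_derivative (1 - t) powr (- s)) (at t)"
proof (cases "s = 1")
  case True
  have "((\<lambda>t. - ln (1 - t)) has_field_derivative (1 - t) powr (- s)) (at t)"
    using assms True by (auto intro!: derivative_eq_intros simp: powr_minus_divide)
  then show ?thesis
    using True by (simp add: integrated_weight_def[abs_def])
next
  case False
  have "((\<lambda>t. (1 - t) powr (1 - s) / (s - 1)) has_field_derivative (1 - t) powr (- s)) (at t)"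
  proof -
    have "((\<lambda>t. (1 - t) powr (1 - s)) has_field_derivative
        (1 - s) * (1 - t) powr (1 - s - of_nat 1) * (- 1)) (at t)"
      using assms by (intro DERIV_fun_powr) (auto intro!: derivative_eq_intros)
    from DERIV_cdivide[OF this, of "s - 1"] show ?thesis
      using False by (simp add: minus_mult_commute flip: mult_minus_left)
  qed
  then show ?thesis
    using False by (simp add: integrated_weight_def[abs_def])
qed

lemma integrated_weight_growth:
  assumes "0 < s"
  obtains C where "0 < C"
    "\<And>r. 0 \<le> r \<Longrightarrow> r < 1 \<Longrightarrow>
       integrated_weight s r - integrated_weight s 0 \<le> C * growth (s - 1) (1 - r\<^sup>2)"
proof (cases s "1::real" rule: linorder_cases)
  case less
  have "(1 - r) powr (1 - s) / (s - 1) - 1 / (s - 1) \<le> 1 / (1 - s)" if "0 \<le> r" "r < 1" for r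
  proof -
    have "0 \<le> (1 - r) powr (1 - s) / (1 - s)"
      using less by simp
    then show ?thesis
      using minus_divide_right[of "(1 - r) powr (1 - s)" "1 - s"] minus_divide_right[of 1 "1 - s"]
      by simp
  qed
  then show ?thesis
    using less by (intro that[of "1 / (1 - s)"]) (auto simp: integrated_weight_def growth_def)
next
  case equal
  have "- ln (1 - r) \<le> ln (2 / (1 - r\<^sup>2))" if "0 \<le> r" "r < 1" for r :: real
  proof -
    note b = one_minus_square_bounds[OF that]
    have "1 / (1 - r) \<le> 2 / (1 - r\<^sup>2)"
      using b that by (simp add: field_simps)
    then have "ln (1 / (1 - r)) \<le> ln (2 / (1 - r\<^sup>2))"
      using that by (intro ln_mono) auto
    then show ?thesis
      using that by (simp add: ln_div)
  qed
  then show ?thesis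
    using equal by (intro that[of 1]) (auto simp: integrated_weight_def growth_def)
next
  case greater
  have "(1 - r) powr (1 - s) / (s - 1) - 1 / (s - 1)
      \<le> 2 powr (s - 1) / (s - 1) * (1 - r\<^sup>2) powr (- (s - 1))" if "0 \<le> r" "r < 1" for r
  proof -
    note b = one_minus_square_bounds[OF that]
    have "(1 - r) powr (1 - s) \<le> ((1 - r\<^sup>2) / 2) powr (1 - s)"
      using greater b by (intro powr_mono2') auto
    also have "\<dots> = 2 powr (s - 1) * (1 - r\<^sup>2) powr (- (s - 1))"
      using b by (simp add: powr_divide powr_diff field_simps)
    finally have "(1 - r) powr (1 - s) / (s - 1)
        \<le> 2 powr (s - 1) * (1 - r\<^sup>2) powr (- (s - 1)) / (s - 1)"
      using greater by (intro divide_right_mono) auto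
    moreover have "1 / (s - 1) \<ge> 0"
      using greater by simp
    ultimately show ?thesis
      by (simp only: times_divide_eq_left)
  qed
  then show ?thesis
    using greater
    by (intro that[of "2 powr (s - 1) / (s - 1)"]) (auto simp: integrated_weight_def growth_def)
qed

text \<open>
  Along the segment from \<open>0\<close> to \<open>z\<close> the function \<open>t \<mapsto> F (t z)\<close> has a derivative dominated by that of
  \<open>t \<mapsto> M * integrated_weight s (t |z|)\<close>, because \<open>1 - t\<^sup>2 |z|\<^sup>2 \<ge> 1 - t |z|\<close>. The mean value inequality
  then compares the increments.
\<close>

lemma holomorphic_growth_from_derivative:
  assumes "0 < s"
  obtains C where "0 < C"
    "\<And>F M z. \<lbrakk>F holomorphic_on unit_disc; 0 \<le> M;
        \<And>w. w \<in> unit_disc \<Longrightarrow> cmod (deriv F w) \<le> M * (1 - (cmod w)\<^sup>2) powr (- s); z \<in> unit_disc\<rbrakk>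
      \<Longrightarrow> cmod (F z) \<le> cmod (F 0) + M * C * growth (s - 1) (1 - (cmod z)\<^sup>2)"
proof -
  obtain C where C: "0 < C"
    "\<And>r. 0 \<le> r \<Longrightarrow> r < 1 \<Longrightarrow>
       integrated_weight s r - integrated_weight s 0 \<le> C * growth (s - 1) (1 - r\<^sup>2)"
    using integrated_weight_growth[OF assms] by blast
  have "cmod (F z) \<le> cmod (F 0) + M * C * growth (s - 1) (1 - (cmod z)\<^sup>2)"
    if F: "F holomorphic_on unit_disc" and M: "0 \<le> M"
      and bound: "\<And>w. w \<in> unit_disc \<Longrightarrow> cmod (deriv F w) \<le> M * (1 - (cmod w)\<^sup>2) powr (- s)"
      and z: "z \<in> unit_disc" for F M z
  proof -
    define r where "r = cmod z"
    have r: "0 \<le> r" "r < 1"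
      using z by (auto simp: r_def)
    have seg: "of_real t * z \<in> unit_disc" "t * r < 1" if "0 \<le> t" "t \<le> 1" for t
    proof -
      have "t * r \<le> 1 * r"
        using that r by (intro mult_right_mono) auto
      then show "t * r < 1" "of_real t * z \<in> unit_disc"
        using r that by (auto simp: norm_mult r_def)
    qed
    have dF: "((\<lambda>t. F (of_real t * z)) has_vector_derivative z * deriv F (of_real t * z)) (at t)"
      if "0 \<le> t" "t \<le> 1" for t
    proof -
      have "(F has_field_derivative deriv F (of_real t * z)) (at (of_real t * z))"
        using holomorphic_derivI[OF F _ seg(1)[OF that]] by simp
      moreover have "((\<lambda>t. of_real t * z) has_vector_derivative z) (at t)"
        by (auto intro!: derivative_eq_intros)
      ultimately show ?thesis
        using field_vector_diff_chain_at[of "\<lambda>t. of_real t * z" z t F] by (simp add: o_def)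
    qed
    have dW: "((\<lambda>t. M * integrated_weight s (t * r)) has_vector_derivative
        M * (r * (1 - t * r) powr (- s))) (at t)" if "0 \<le> t" "t \<le> 1" for t
    proof -
      have "((\<lambda>t. integrated_weight s (t * r)) has_field_derivative
          (1 - t * r) powr (- s) * r) (at t)"
        by (rule DERIV_chain2[where g = "\<lambda>t. t * r"], rule integrated_weight_deriv[OF seg(2)[OF that]])
          (auto intro!: derivative_eq_intros)
      from DERIV_cmult[OF this, of M] show ?thesis
        by (simp add: has_real_derivative_iff_has_vector_derivative mult_ac)
    qed
    have "cmod (F (of_real 1 * z) - F (of_real 0 * z))
        \<le> M * integrated_weight s (1 * r) - M * integrated_weight s (0 * r)"
    proof (rule differentiable_bound_general)
      show "continuous_on {0..1} (\<lambda>t. F (of_real t * z))"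
        using has_vector_derivative_continuous[OF dF]
        by (intro continuous_at_imp_continuous_on) auto
      show "continuous_on {0..1} (\<lambda>t. M * integrated_weight s (t * r))"
        using has_vector_derivative_continuous[OF dW]
        by (intro continuous_at_imp_continuous_on) auto
    next
      fix t :: real assume t: "0 < t" "t < 1"
      show "((\<lambda>t. F (of_real t * z)) has_vector_derivative z * deriv F (of_real t * z)) (at t)"
        using dF t by simp
      show "((\<lambda>t. M * integrated_weight s (t * r)) has_vector_derivative
          M * (r * (1 - t * r) powr (- s))) (at t)"
        using dW t by simp
      have w: "cmod (of_real t * z) = t * r"
        using t by (simp add: norm_mult r_def)
      have tr: "0 \<le> t * r" "t * r < 1"
        using seg[of t] t r by auto
      have "(1 - (t * r)\<^sup>2) powr (- s) \<le> (1 - t * r) powr (- s)"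
        using one_minus_square_bounds[OF tr] tr assms by (intro powr_mono2') auto
      then have "cmod (deriv F (of_real t * z)) \<le> M * (1 - t * r) powr (- s)"
        using bound[OF seg(1)[of t]] t M unfolding w
        by (meson less_imp_le mult_left_mono order_trans)
      then have "cmod (z * deriv F (of_real t * z)) \<le> r * (M * (1 - t * r) powr (- s))"
        using r by (simp add: norm_mult r_def mult_left_mono)
      then show "cmod (z * deriv F (of_real t * z)) \<le> M * (r * (1 - t * r) powr (- s))"
        by (simp add: mult_ac)
    qed simp
    then have "cmod (F z - F 0) \<le> M * (integrated_weight s r - integrated_weight s 0)"
      by (simp add: algebra_simps)
    also have "\<dots> \<le> M * (C * growth (s - 1) (1 - r\<^sup>2))"
      using C(2)[OF r] M by (intro mult_left_mono) auto
    finally show ?thesis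
      using norm_triangle_ineq2[of "F z" "F 0"] by (simp add: r_def mult_ac)
  qed
  then show ?thesis
    using that C(1) by blast
qed


section \<open>Powers with polynomial and logarithmic weights\<close>

lemma one_minus_power_le:
  assumes "0 \<le> r" "r < (1::real)"
  shows "r ^ n \<le> exp (- (real n * (1 - r)))"
proof -
  have "r \<le> exp (- (1 - r))"
    using exp_ge_add_one_self[of "- (1 - r)"] by simp
  then have "r ^ n \<le> exp (- (1 - r)) ^ n"
    using assms by (intro power_mono) auto
  then show ?thesis
    by (simp add: exp_of_nat_mult[symmetric] algebra_simps)
qed

text \<open>
  The maximum of \<open>n \<mapsto> (n + 1) powr s * r ^ n\<close> is attained near \<open>n = s / (1 - r)\<close> when \<open>r\<close> is close to \<open>1\<close>. Up to constants, any
  exponent of that order serves as well. The floor of \<open>r / (1 - r)\<close> is small enough for \<open>r ^ n\<close> to stay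
  above \<open>exp (- 1) \<ge> 1 / 3\<close>, including at \<open>r = 0\<close>, where it gives \<open>n = 0\<close>.
\<close>

lemma critical_exponent:
  assumes "0 \<le> r" "r < (1::real)"
  obtains n :: nat where "1 / 3 \<le> r ^ n" "1 / (1 - r\<^sup>2) \<le> real n + 2"
proof -
  note b = one_minus_square_bounds[OF assms]
  define n where "n = nat \<lfloor>r / (1 - r)\<rfloor>"
  have rr: "0 \<le> r / (1 - r)"
    using assms by simp
  have n1: "real n \<le> r / (1 - r)" and n2: "r / (1 - r) < real n + 1"
    using rr by (simp_all add: n_def of_nat_floor)
  have "1 / (1 - r\<^sup>2) \<le> 1 / (1 - r)"
    using assms b by (intro divide_left_mono) auto
  also have "\<dots> = r / (1 - r) + 1"
    using assms by (simp add: field_simps)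
  finally have up: "1 / (1 - r\<^sup>2) \<le> real n + 2"
    using n2 by simp
  have "1 / 3 \<le> r ^ n"
  proof (cases "r = 0")
    case True
    then show ?thesis
      by (simp add: n_def)
  next
    case False
    then have r: "0 < r"
      using assms by simp
    have "1 / r \<le> exp (1 / r - 1)"
      using exp_ge_add_one_self[of "1 / r - 1"] by simp
    then have "(1 / r) ^ n \<le> exp (1 / r - 1) ^ n"
      using r by (intro power_mono) auto
    also have "\<dots> = exp (real n * (1 / r - 1))"
      by (simp add: exp_of_nat_mult)
    also have "real n * (1 / r - 1) \<le> r / (1 - r) * (1 / r - 1)"
      using n1 r assms by (intro mult_right_mono) (auto simp: field_simps)
    also have "\<dots> = 1"
      using r assms by (simp add: field_simps)
    also have "exp 1 \<le> (3::real)"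
      by (rule exp_le)
    finally have "(1 / r) ^ n \<le> 3"
      by simp
    then show ?thesis
      using r by (simp add: power_one_over field_simps)
  qed
  with up show ?thesis
    using that by blast
qed

text \<open>
  With \<open>y = n (1 - r)\<close> one has \<open>r ^ n \<le> exp (- y)\<close>, while \<open>((n + 1) (1 - r)) powr s\<close> is at most
  \<open>(y + 1) powr s\<close>, which is at most a constant times \<open>exp y\<close>. This gives the upper bound; the critical exponent
  gives the lower one.
\<close>

lemma polynomial_weights_match_growth:
  assumes s: "0 < s"
  obtains K where "0 < K"
    "\<And>r n. 0 \<le> r \<Longrightarrow> r < 1 \<Longrightarrow> (real n + 1) powr s * r ^ n \<le> K * growth s (1 - r\<^sup>2)"
    "\<And>r. 0 \<le> r \<Longrightarrow> r < 1 \<Longrightarrow> \<exists>n. growth s (1 - r\<^sup>2) \<le> K * ((real n + 1) powr s * r ^ n)"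
proof -
  define m where "m = max 1 s"
  define K where "K = max ((2 * m) powr s) (3 * 2 powr s)"
  have m: "1 \<le> m" "s \<le> m"
    by (auto simp: m_def)
  have up: "(real n + 1) powr s * r ^ n \<le> (2 * m) powr s * growth s (1 - r\<^sup>2)"
    if r: "0 \<le> r" "r < 1" for r n
  proof -
    note b = one_minus_square_bounds[OF r]
    define y where "y = real n * (1 - r)"
    have y: "0 \<le> y"
      using r by (simp add: y_def)
    have "(real n + 1) * (1 - r) \<le> y + 1"
      using r by (simp add: y_def algebra_simps)
    also have "\<dots> \<le> m * (1 + y / s)"
    proof -
      have "y * 1 \<le> y * (m / s)"
        using m s y by (intro mult_left_mono) auto
      then show ?thesis
        using m by (simp add: algebra_simps)
    qed
    also have "\<dots> \<le> m * exp (y / s)"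
      using m exp_ge_add_one_self[of "y / s"] by (intro mult_left_mono) auto
    finally have "real n + 1 \<le> m * exp (y / s) / (1 - r)"
      using r by (simp add: field_simps)
    also have "\<dots> \<le> m * exp (y / s) * (2 / (1 - r\<^sup>2))"
    proof -
      have "1 / (1 - r) \<le> 2 / (1 - r\<^sup>2)"
        using b r by (simp add: field_simps)
      then have "m * exp (y / s) * (1 / (1 - r)) \<le> m * exp (y / s) * (2 / (1 - r\<^sup>2))"
        using m by (intro mult_left_mono) auto
      then show ?thesis by simp
    qed
    finally have "(real n + 1) powr s \<le> (m * exp (y / s) * (2 / (1 - r\<^sup>2))) powr s"
      using s by (intro powr_mono2) auto
    also have "\<dots> = (2 * m) powr s * growth s (1 - r\<^sup>2) * exp y"
      using m b s
      by (simp add: powr_mult powr_divide growth_def powr_minus_divide exp_powr_real)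
    finally have "(real n + 1) powr s * r ^ n
        \<le> (2 * m) powr s * growth s (1 - r\<^sup>2) * exp y * exp (- y)"
      using one_minus_power_le[OF r, of n] growth_nonneg[OF b(1,2), of s] r
      by (intro mult_mono) (auto simp: y_def)
    moreover have "exp y * exp (- y) = 1"
      by (simp flip: exp_add)
    ultimately show ?thesis
      by (simp add: mult.assoc)
  qed
  have low: "\<exists>n. growth s (1 - r\<^sup>2) \<le> 3 * 2 powr s * ((real n + 1) powr s * r ^ n)"
    if r: "0 \<le> r" "r < 1" for r
  proof -
    note b = one_minus_square_bounds[OF r]
    obtain n :: nat where n: "1 / 3 \<le> r ^ n" "1 / (1 - r\<^sup>2) \<le> real n + 2"
      using critical_exponent[OF r] by blast
    have "growth s (1 - r\<^sup>2) = (1 / (1 - r\<^sup>2)) powr s"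
      using s b by (simp add: growth_def powr_minus_divide powr_divide)
    also have "\<dots> \<le> (2 * (real n + 1)) powr s"
      using n s b by (intro powr_mono2) auto
    also have "\<dots> = 3 * 2 powr s * ((real n + 1) powr s * (1 / 3))"
      by (subst powr_mult) auto
    also have "\<dots> \<le> 3 * 2 powr s * ((real n + 1) powr s * r ^ n)"
      using n by (intro mult_left_mono) auto
    finally show ?thesis by blast
  qed
  show ?thesis
  proof (rule that[of K])
    show "0 < K"
      by (simp add: K_def less_max_iff_disj)
    show "(real n + 1) powr s * r ^ n \<le> K * growth s (1 - r\<^sup>2)" if r: "0 \<le> r" "r < 1" for r n
    proof -
      have "(2 * m) powr s * growth s (1 - r\<^sup>2) \<le> K * growth s (1 - r\<^sup>2)"
        using growth_nonneg one_minus_square_bounds[OF r]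
        by (intro mult_right_mono) (auto simp: K_def)
      with up[OF r, of n] show ?thesis by simp
    qed
    show "\<exists>n. growth s (1 - r\<^sup>2) \<le> K * ((real n + 1) powr s * r ^ n)" if r: "0 \<le> r" "r < 1" for r
    proof -
      obtain n where "growth s (1 - r\<^sup>2) \<le> 3 * 2 powr s * ((real n + 1) powr s * r ^ n)"
        using low[OF r] by blast
      also have "\<dots> \<le> K * ((real n + 1) powr s * r ^ n)"
        using r by (intro mult_right_mono) (auto simp: K_def)
      finally show ?thesis by blast
    qed
  qed
qed

text \<open>
  Here \<open>n + 2 \<le> (y + 2) / (1 - r)\<close> with \<open>y = n (1 - r)\<close>, so that \<open>ln (n + 2)\<close> exceeds \<open>ln (1 / (1 - r))\<close>
  by at most \<open>y + 1 \<le> exp y\<close>, and \<open>r ^ n \<le> exp (- y)\<close> compensates.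
\<close>

lemma logarithmic_weights_match_growth:
  assumes r: "0 \<le> r" "r < 1"
  shows "ln (real n + 2) * r ^ n \<le> 6 * growth 0 (1 - r\<^sup>2)"
    and "\<exists>n. growth 0 (1 - r\<^sup>2) \<le> 6 * (ln (real n + 2) * r ^ n)"
proof -
  note b = one_minus_square_bounds[OF r]
  define L where "L = growth 0 (1 - r\<^sup>2)"
  have L: "1 / 2 \<le> L"
    using growth_ge_half[OF b(1,2)] by (simp add: L_def)
  define y where "y = real n * (1 - r)"
  have y: "0 \<le> y"
    using r by (simp add: y_def)
  have "real n + 2 \<le> (y + 2) * (1 / (1 - r))"
    using r by (simp add: y_def field_simps)
  then have "ln (real n + 2) \<le> ln ((y + 2) * (1 / (1 - r)))"
    by (intro ln_mono) auto
  also have "\<dots> = ln (y + 2) + ln (1 / (1 - r))"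
    using y r by (intro ln_mult_pos) auto
  also have "\<dots> \<le> (y + 1) + L"
  proof (rule add_mono)
    show "ln (y + 2) \<le> y + 1"
      using ln_le_minus_one[of "y + 2"] y by simp
    have "1 / (1 - r) \<le> 2 / (1 - r\<^sup>2)"
      using b r by (simp add: field_simps)
    then show "ln (1 / (1 - r)) \<le> L"
      unfolding L_def growth_def using r by (auto intro!: ln_mono)
  qed
  also have "\<dots> \<le> 6 * L * exp y"
  proof -
    have "y + 1 \<le> 1 * exp y"
      using exp_ge_add_one_self[of y] by (simp add: add.commute)
    also have "\<dots> \<le> 2 * L * exp y"
      using L by (intro mult_right_mono) auto
    finally have "y + 1 \<le> 2 * L * exp y" .
    moreover have "L * 1 \<le> L * exp y"
      using L y by (intro mult_left_mono) auto
    moreover have "0 \<le> L * exp y"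
      using L by simp
    ultimately show ?thesis by linarith
  qed
  finally have "ln (real n + 2) * r ^ n \<le> 6 * L * exp y * exp (- y)"
    using one_minus_power_le[OF r, of n] L r by (intro mult_mono) (auto simp: y_def)
  moreover have "exp y * exp (- y) = 1"
    by (simp flip: exp_add)
  ultimately show "ln (real n + 2) * r ^ n \<le> 6 * growth 0 (1 - r\<^sup>2)"
    by (simp add: L_def mult.assoc)
  obtain k :: nat where k: "1 / 3 \<le> r ^ k" "1 / (1 - r\<^sup>2) \<le> real k + 2"
    using critical_exponent[OF r] by blast
  have "L = ln 2 + ln (1 / (1 - r\<^sup>2))"
    using b by (simp add: L_def growth_def ln_div)
  also have "\<dots> \<le> ln (real k + 2) + ln (real k + 2)"
    using k b by (intro add_mono ln_mono) auto
  also have "\<dots> = 6 * (ln (real k + 2) * (1 / 3))"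
    by simp
  also have "\<dots> \<le> 6 * (ln (real k + 2) * r ^ k)"
    using k by (intro mult_left_mono) auto
  finally show "\<exists>n. growth 0 (1 - r\<^sup>2) \<le> 6 * (ln (real n + 2) * r ^ n)"
    unfolding L_def by blast
qed

section \<open>Zygmund spaces\<close>

lemma ennreal_SUP_finite_iff:
  "(SUP z\<in>S. ennreal (F z)) < \<infinity> \<longleftrightarrow> (\<exists>M\<ge>0. \<forall>z\<in>S. F z \<le> M)" (is "?L \<longleftrightarrow> ?R")
proof
  assume ?L
  then obtain M where M: "(SUP z\<in>S. ennreal (F z)) = ennreal M" "0 \<le> M"
    by (cases "SUP z\<in>S. ennreal (F z)") (auto simp: top_unique)
  have "F z \<le> M" if "z \<in> S" for z
  proof -
    have "ennreal (F z) \<le> ennreal M"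
      unfolding M(1)[symmetric] using that by (rule SUP_upper)
    then show ?thesis using M(2) by simp
  qed
  then show ?R using M(2) by blast
next
  assume ?R
  then obtain M where "\<forall>z\<in>S. F z \<le> M" by blast
  then have "(SUP z\<in>S. ennreal (F z)) \<le> ennreal M"
    by (intro SUP_least ennreal_leI) auto
  also have "\<dots> < \<infinity>"
    by simp
  finally show ?L .
qed

lemma weighted_norm_le_iff:
  assumes "0 \<le> M"
  shows "weighted_norm \<beta> h \<le> ennreal M \<longleftrightarrow>
    (\<forall>z\<in>unit_disc. (1 - (cmod z)\<^sup>2) powr \<beta> * cmod (h z) \<le> M)"
  unfolding weighted_norm_def SUP_le_iff using assms by simp

lemma zygmund_spaceE:
  assumes f: "f \<in> zygmund_space \<alpha>"
  obtains N where "0 \<le> N" "zygmund_norm \<alpha> f = ennreal N" "cmod (f 0) \<le> N" "cmod (deriv f 0) \<le> N"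
    "\<And>z. z \<in> unit_disc \<Longrightarrow> (1 - (cmod z)\<^sup>2) powr \<alpha> * cmod (deriv (deriv f) z) \<le> N"
proof -
  have "weighted_norm \<alpha> (deriv (deriv f)) < \<infinity>"
    using f by (simp add: zygmund_space_def)
  then obtain M where M: "weighted_norm \<alpha> (deriv (deriv f)) = ennreal M" "0 \<le> M"
    by (cases "weighted_norm \<alpha> (deriv (deriv f))") (auto simp: top_unique)
  define N where "N = cmod (f 0) + cmod (deriv f 0) + M"
  show ?thesis
  proof (rule that[of N])
    show "0 \<le> N" "cmod (f 0) \<le> N" "cmod (deriv f 0) \<le> N"
      using M(2) by (auto simp: N_def)
    show "zygmund_norm \<alpha> f = ennreal N"
      using M by (simp add: zygmund_norm_def N_def)
    show "(1 - (cmod z)\<^sup>2) powr \<alpha> * cmod (deriv (deriv f) z) \<le> N" if "z \<in> unit_disc" for z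
    proof -
      have "(1 - (cmod z)\<^sup>2) powr \<alpha> * cmod (deriv (deriv f) z) \<le> M"
        using weighted_norm_le_iff[OF M(2), of \<alpha> "deriv (deriv f)"] M(1) that by auto
      then show ?thesis by (simp add: N_def add_increasing)
    qed
  qed
qed

lemma zygmund_spaceI:
  assumes f: "f holomorphic_on unit_disc" and "0 \<le> M"
    and "\<And>z. z \<in> unit_disc \<Longrightarrow> (1 - (cmod z)\<^sup>2) powr \<alpha> * cmod (deriv (deriv f) z) \<le> M"
  shows "f \<in> zygmund_space \<alpha>"
    and "zygmund_norm \<alpha> f \<le> ennreal (cmod (f 0) + cmod (deriv f 0) + M)"
proof -
  have le: "weighted_norm \<alpha> (deriv (deriv f)) \<le> ennreal M"
    using assms by (subst weighted_norm_le_iff) auto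
  then show "f \<in> zygmund_space \<alpha>"
    using f by (auto simp: zygmund_space_def intro: order.strict_trans1)
  have "zygmund_norm \<alpha> f \<le> ennreal (cmod (f 0)) + ennreal (cmod (deriv f 0)) + ennreal M"
    unfolding zygmund_norm_def by (intro add_mono le order_refl)
  then show "zygmund_norm \<alpha> f \<le> ennreal (cmod (f 0) + cmod (deriv f 0) + M)"
    using assms(2) by simp
qed

lemma deriv_deriv_on_open:
  assumes "open S" "z \<in> S"
    and "\<And>z. z \<in> S \<Longrightarrow> (f has_field_derivative f1 z) (at z)"
    and "\<And>z. z \<in> S \<Longrightarrow> (f1 has_field_derivative f2 z) (at z)"
  shows "deriv f z = f1 z" "deriv (deriv f) z = (f2 z :: complex)"
proof -
  show "deriv f z = f1 z"
    using assms DERIV_imp_deriv by blast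
  have "(deriv f has_field_derivative f2 z) (at z)"
    by (rule has_field_derivative_transform_within_open[OF assms(4) assms(1)])
      (use assms in \<open>auto dest: DERIV_imp_deriv[OF assms(3)]\<close>)
  then show "deriv (deriv f) z = f2 z"
    by (rule DERIV_imp_deriv)
qed

text \<open>
  Two radial integrations. The bound on \<open>f''\<close> is of order \<open>\<alpha>\<close> and yields \<open>growth (\<alpha> - 1)\<close> for \<open>f'\<close>. For
  \<open>\<alpha> > 1\<close> this is a power of positive order, which can be integrated again. For \<open>\<alpha> \<le> 1\<close> it is
  replaced by the power of order \<open>1 / 2\<close>, and the result is bounded, as \<open>growth (\<alpha> - 2)\<close> is.
\<close>

lemma zygmund_space_growth:
  assumes "0 < \<alpha>"
  obtains C where "0 < C"
    "\<And>f N z. \<lbrakk>f \<in> zygmund_space \<alpha>; zygmund_norm \<alpha> f \<le> ennreal N; 0 \<le> N; z \<in> unit_disc\<rbrakk> \<Longrightarrow>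
      cmod (deriv f z) \<le> C * N * growth (\<alpha> - 1) (1 - (cmod z)\<^sup>2)"
    "\<And>f N z. \<lbrakk>f \<in> zygmund_space \<alpha>; zygmund_norm \<alpha> f \<le> ennreal N; 0 \<le> N; z \<in> unit_disc\<rbrakk> \<Longrightarrow>
      cmod (f z) \<le> C * N * growth (\<alpha> - 2) (1 - (cmod z)\<^sup>2)"
proof -
  obtain C1 where C1: "0 < C1"
    "\<And>F M z. \<lbrakk>F holomorphic_on unit_disc; 0 \<le> M;
        \<And>w. w \<in> unit_disc \<Longrightarrow> cmod (deriv F w) \<le> M * (1 - (cmod w)\<^sup>2) powr (- \<alpha>); z \<in> unit_disc\<rbrakk>
      \<Longrightarrow> cmod (F z) \<le> cmod (F 0) + M * C1 * growth (\<alpha> - 1) (1 - (cmod z)\<^sup>2)"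
    using holomorphic_growth_from_derivative[OF assms] by blast
  define s where "s = (if \<alpha> \<le> 1 then 1 / 2 else \<alpha> - 1)"
  have s: "0 < s"
    by (simp add: s_def)
  obtain C2 where C2: "0 < C2"
    "\<And>F M z. \<lbrakk>F holomorphic_on unit_disc; 0 \<le> M;
        \<And>w. w \<in> unit_disc \<Longrightarrow> cmod (deriv F w) \<le> M * (1 - (cmod w)\<^sup>2) powr (- s); z \<in> unit_disc\<rbrakk>
      \<Longrightarrow> cmod (F z) \<le> cmod (F 0) + M * C2 * growth (s - 1) (1 - (cmod z)\<^sup>2)"
    using holomorphic_growth_from_derivative[OF s] by blast
  \<comment> \<open>For \<open>\<alpha> \<le> 1\<close> both orders are negative, and the scale is then constantly \<open>1\<close>.\<close>
  have s1: "growth (s - 1) = growth (\<alpha> - 2)"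
    by (auto simp: s_def growth_def fun_eq_iff)
  have s2: "growth (\<alpha> - 1) x \<le> 4 * x powr (- s)" if "0 < x" "x \<le> 1" for x
  proof (cases "\<alpha> \<le> 1")
    case True
    then show ?thesis
      using growth_le_inverse_sqrt[of "\<alpha> - 1" x] that by (simp add: s_def)
  next
    case False
    then show ?thesis
      by (simp add: s_def growth_def)
  qed
  define D1 where "D1 = 2 + C1"
  define D2 where "D2 = 2 + 4 * D1 * C2"
  have D: "0 < D1" "0 < D2"
    using C1(1) C2(1) by (auto simp: D1_def D2_def add_pos_pos)
  have N_le: "N \<le> 2 * N * growth t (1 - (cmod z)\<^sup>2)" if "0 \<le> N" "z \<in> unit_disc" for N t z
    using mult_left_mono[OF growth_ge_half[OF disc_weight_bounds[OF that(2)], of t] that(1)] by simp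
  have first: "cmod (deriv f z) \<le> D1 * N * growth (\<alpha> - 1) (1 - (cmod z)\<^sup>2)"
    if f: "f \<in> zygmund_space \<alpha>" "zygmund_norm \<alpha> f \<le> ennreal N" "0 \<le> N" and z: "z \<in> unit_disc" for f N z
  proof -
    obtain N' where N': "0 \<le> N'" "zygmund_norm \<alpha> f = ennreal N'" "cmod (deriv f 0) \<le> N'"
      "\<And>z. z \<in> unit_disc \<Longrightarrow> (1 - (cmod z)\<^sup>2) powr \<alpha> * cmod (deriv (deriv f) z) \<le> N'"
      using zygmund_spaceE[OF f(1)] by metis
    have NN: "N' \<le> N"
      using f N' by simp
    have "cmod (deriv (deriv f) w) \<le> N * (1 - (cmod w)\<^sup>2) powr (- \<alpha>)" if "w \<in> unit_disc" for w
      using N'(4)[OF that] NN disc_weight_bounds[OF that]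
      by (simp add: powr_minus_divide field_simps)
    then have "cmod (deriv f z) \<le> cmod (deriv f 0) + N * C1 * growth (\<alpha> - 1) (1 - (cmod z)\<^sup>2)"
      using f z by (intro C1(2)) (auto simp: zygmund_space_def intro!: holomorphic_intros)
    then show ?thesis
      using N'(3) NN N_le[OF f(3) z, of "\<alpha> - 1"] by (simp add: D1_def algebra_simps)
  qed
  have second: "cmod (f z) \<le> D2 * N * growth (\<alpha> - 2) (1 - (cmod z)\<^sup>2)"
    if f: "f \<in> zygmund_space \<alpha>" "zygmund_norm \<alpha> f \<le> ennreal N" "0 \<le> N" and z: "z \<in> unit_disc" for f N z
  proof -
    obtain N' where N': "0 \<le> N'" "zygmund_norm \<alpha> f = ennreal N'" "cmod (f 0) \<le> N'"
      using zygmund_spaceE[OF f(1)] by metis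
    have NN: "N' \<le> N"
      using f N' by simp
    have "cmod (deriv f w) \<le> (4 * D1 * N) * (1 - (cmod w)\<^sup>2) powr (- s)" if "w \<in> unit_disc" for w
    proof -
      have "cmod (deriv f w) \<le> (D1 * N) * (4 * (1 - (cmod w)\<^sup>2) powr (- s))"
        using first[OF f that] s2[OF disc_weight_bounds[OF that]] D f(3)
        by (meson less_imp_le mult_left_mono mult_nonneg_nonneg order_trans)
      then show ?thesis by (simp add: mult_ac)
    qed
    then have "cmod (f z) \<le> cmod (f 0) + (4 * D1 * N) * C2 * growth (s - 1) (1 - (cmod z)\<^sup>2)"
      using f z D by (intro C2(2)) (auto simp: zygmund_space_def)
    then show ?thesis
      using N'(3) NN N_le[OF f(3) z, of "\<alpha> - 2"] by (simp add: D2_def s1 algebra_simps)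
  qed
  define C where "C = max D1 D2"
  have up: "D1 * N * growth t (1 - (cmod z)\<^sup>2) \<le> C * N * growth t (1 - (cmod z)\<^sup>2)"
    "D2 * N * growth t (1 - (cmod z)\<^sup>2) \<le> C * N * growth t (1 - (cmod z)\<^sup>2)"
    if "0 \<le> N" "z \<in> unit_disc" for N t z
    using that growth_nonneg[OF disc_weight_bounds[OF that(2)]]
    by (auto intro!: mult_right_mono simp: C_def)
  show ?thesis
  proof (rule that[of C])
    show "0 < C" using D by (simp add: C_def)
  qed (use first second up in \<open>meson order_trans\<close>)+
qed

section \<open>Test functions\<close>

text \<open>
  The analytic counterpart of \<open>growth s\<close>: the real quantity \<open>1 - |z|\<^sup>2\<close> is polarised to \<open>1 - (cnj a) z\<close>,
  with which it agrees at \<open>z = a\<close>.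
\<close>

definition disc_kernel :: "real \<Rightarrow> complex \<Rightarrow> complex \<Rightarrow> complex" where
  "disc_kernel s a z = (if s < 0 then 1 else if s = 0 then of_real (ln 2) - Ln (1 - cnj a * z)
     else (1 - cnj a * z) powr (- of_real s))"

text \<open>
  The factor produced by the first differentiation. With it one formula covers the derivatives of the
  constant, logarithmic and power kernels.
\<close>

definition disc_kernel_coeff :: "real \<Rightarrow> real" where
  "disc_kernel_coeff s = (if s < 0 then 0 else if s = 0 then 1 else s)"

lemma disc_kernel_coeff_nonneg: "0 \<le> disc_kernel_coeff s"
  by (simp add: disc_kernel_coeff_def)

text \<open>
  The last estimate says that the Moebius map sending \<open>a\<close> to \<open>0\<close> preserves the disc. It comes from the
  identity \<open>|1 - (cnj a) z|\<^sup>2 - |z - a|\<^sup>2 = (1 - |a|\<^sup>2) (1 - |z|\<^sup>2)\<close>, and it shows that a factor \<open>z - a\<close> makes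
  up for one extra power of \<open>1 - (cnj a) z\<close> in the denominator.
\<close>

lemma disc_denominator:
  assumes a: "a \<in> unit_disc" and z: "z \<in> unit_disc"
  shows "1 - cnj a * z \<notin> \<real>\<^sub>\<le>\<^sub>0" "1 - (cmod z)\<^sup>2 \<le> 2 * cmod (1 - cnj a * z)" "0 < cmod (1 - cnj a * z)"
    and "cmod (z - a) \<le> cmod (1 - cnj a * z)"
proof -
  have le: "cmod (cnj a * z) \<le> cmod z"
    using a z mult_right_mono[of "cmod a" 1 "cmod z"] by (simp add: norm_mult)
  then have lt: "cmod (cnj a * z) < 1"
    using z by simp
  have re: "0 < Re (1 - cnj a * z)"
    using complex_Re_le_cmod[of "cnj a * z"] lt by (simp only: minus_complex.sel one_complex.sel)
  then show "1 - cnj a * z \<notin> \<real>\<^sub>\<le>\<^sub>0"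
    by (auto simp: complex_nonpos_Reals_iff)
  from re show "0 < cmod (1 - cnj a * z)"
    using complex_Re_le_cmod[of "1 - cnj a * z"] by linarith
  have "1 - cmod z \<le> cmod (1 - cnj a * z)"
    using norm_triangle_ineq2[of 1 "cnj a * z"] le by simp
  then show "1 - (cmod z)\<^sup>2 \<le> 2 * cmod (1 - cnj a * z)"
    using one_minus_square_bounds[of "cmod z"] z by simp
  have "(cmod (1 - cnj a * z))\<^sup>2 - (cmod (z - a))\<^sup>2 = (1 - (cmod a)\<^sup>2) * (1 - (cmod z)\<^sup>2)"
    by (simp only: cmod_power2) (simp add: power2_eq_square algebra_simps)
  moreover have "0 \<le> (1 - (cmod a)\<^sup>2) * (1 - (cmod z)\<^sup>2)"
    using disc_weight_bounds[OF a] disc_weight_bounds[OF z] by simp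
  ultimately have "(cmod (z - a))\<^sup>2 \<le> (cmod (1 - cnj a * z))\<^sup>2"
    by linarith
  then show "cmod (z - a) \<le> cmod (1 - cnj a * z)"
    by (rule power2_le_imp_le) simp
qed

lemma disc_kernel_deriv:
  assumes "a \<in> unit_disc" "z \<in> unit_disc"
  shows "(disc_kernel s a has_field_derivative
      of_real (disc_kernel_coeff s) * cnj a * (1 - cnj a * z) powr (- of_real (s + 1))) (at z)"
    and "((\<lambda>z. of_real (disc_kernel_coeff s) * cnj a * (1 - cnj a * z) powr (- of_real (s + 1)))
      has_field_derivative
      of_real (disc_kernel_coeff s * (s + 1)) * (cnj a)\<^sup>2 * (1 - cnj a * z) powr (- of_real (s + 2))) (at z)"
proof -
  note nz = disc_denominator(1)[OF assms]
  have nz0: "1 - cnj a * z \<noteq> 0"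
    using disc_denominator(3)[OF assms] by auto
  have lin: "((\<lambda>z. 1 - cnj a * z) has_field_derivative - cnj a) (at z)"
    by (auto intro!: derivative_eq_intros)
  have pw: "((\<lambda>z. (1 - cnj a * z) powr (- of_real t)) has_field_derivative
      of_real t * cnj a * (1 - cnj a * z) powr (- of_real (t + 1))) (at z)" for t
  proof -
    have "- of_real t - 1 = - (of_real (t + 1) :: complex)"
      by simp
    then show ?thesis
      using DERIV_chain2[OF has_field_derivative_powr[OF nz, of "- of_real t"] lin]
      by (simp only: mult_minus_left mult_minus_right minus_minus mult_ac)
  qed
  have lg: "((\<lambda>z. of_real (ln 2) - Ln (1 - cnj a * z)) has_field_derivative
      cnj a * (1 - cnj a * z) powr (- of_real 1)) (at z)"
    using DERIV_diff[OF DERIV_const DERIV_chain2[OF has_field_derivative_Ln[OF nz] lin], of "of_real (ln 2)"] nz0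
    by (simp add: powr_minus field_simps)
  consider "s < 0" | "s = 0" | "s > 0" by linarith
  then show "(disc_kernel s a has_field_derivative
      of_real (disc_kernel_coeff s) * cnj a * (1 - cnj a * z) powr (- of_real (s + 1))) (at z)"
    using pw[of s] lg by cases (simp_all add: disc_kernel_def[abs_def] disc_kernel_coeff_def)
  show "((\<lambda>z. of_real (disc_kernel_coeff s) * cnj a * (1 - cnj a * z) powr (- of_real (s + 1)))
      has_field_derivative
      of_real (disc_kernel_coeff s * (s + 1)) * (cnj a)\<^sup>2 * (1 - cnj a * z) powr (- of_real (s + 2))) (at z)"
    using DERIV_cmult[OF pw[of "s + 1"], of "of_real (disc_kernel_coeff s) * cnj a"]
    by (simp add: power2_eq_square algebra_simps)
qed

lemma disc_kernel_at_centre: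
  assumes "a \<in> unit_disc"
  shows "disc_kernel s a a = of_real (growth s (1 - (cmod a)\<^sup>2))"
proof -
  define x where "x = 1 - (cmod a)\<^sup>2"
  have x: "0 < x"
    using disc_weight_bounds[OF assms] by (simp add: x_def)
  have eq: "1 - cnj a * a = of_real x"
    using complex_norm_square[of a] by (simp add: x_def mult.commute)
  have "of_real x powr (- of_real s) = complex_of_real (x powr (- s))"
    using powr_of_real[of x "- s"] x by simp
  then show ?thesis
    using x unfolding disc_kernel_def growth_def eq x_def[symmetric]
    by (simp add: Ln_of_real ln_div)
qed

lemma disc_kernel_at_zero: "cmod (disc_kernel s a 0) \<le> 1"
  using ln_2_less_1 by (auto simp: disc_kernel_def)

lemma disc_weight_times_power:
  assumes "a \<in> unit_disc" "z \<in> unit_disc" "0 < \<alpha>"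
  shows "(1 - (cmod z)\<^sup>2) powr \<alpha> * cmod (1 - cnj a * z) powr (- \<alpha>) \<le> 2 powr \<alpha>"
proof -
  note d = disc_denominator[OF assms(1,2)]
  have "(1 - (cmod z)\<^sup>2) powr \<alpha> \<le> (2 * cmod (1 - cnj a * z)) powr \<alpha>"
    using d disc_weight_bounds[OF assms(2)] assms(3) by (intro powr_mono2) auto
  then show ?thesis
    using d by (simp add: powr_mult powr_minus_divide field_simps)
qed

text \<open>
  Since \<open>1 - |z|\<^sup>2 \<le> 2 |1 - (cnj a) z|\<close>, a second derivative of order \<open>\<alpha>\<close> in \<open>1 / |1 - (cnj a) z|\<close> is
  enough for membership, with a norm bound that does not depend on \<open>a\<close>.
\<close>

lemma zygmund_test_functionI:
  assumes a: "a \<in> unit_disc" and \<alpha>: "0 < \<alpha>" and M: "0 \<le> M"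
    and f1: "\<And>z. z \<in> unit_disc \<Longrightarrow> (f has_field_derivative f1 z) (at z)"
    and f2: "\<And>z. z \<in> unit_disc \<Longrightarrow> (f1 has_field_derivative f2 z) (at z)"
    and bound: "\<And>z. z \<in> unit_disc \<Longrightarrow> cmod (f2 z) \<le> M * cmod (1 - cnj a * z) powr (- \<alpha>)"
  shows "f \<in> zygmund_space \<alpha>"
    and "zygmund_norm \<alpha> f \<le> ennreal (cmod (f 0) + cmod (f1 0) + 2 powr \<alpha> * M)"
proof -
  note d = deriv_deriv_on_open[where S = unit_disc, OF open_ball _ f1 f2]
  have hol: "f holomorphic_on unit_disc"
    unfolding holomorphic_on_open[OF open_ball] using f1 by blast
  have le: "(1 - (cmod z)\<^sup>2) powr \<alpha> * cmod (deriv (deriv f) z) \<le> 2 powr \<alpha> * M"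
    if z: "z \<in> unit_disc" for z
  proof -
    have "(1 - (cmod z)\<^sup>2) powr \<alpha> * cmod (f2 z)
        \<le> (1 - (cmod z)\<^sup>2) powr \<alpha> * (M * cmod (1 - cnj a * z) powr (- \<alpha>))"
      by (intro mult_left_mono bound z) auto
    also have "\<dots> = M * ((1 - (cmod z)\<^sup>2) powr \<alpha> * cmod (1 - cnj a * z) powr (- \<alpha>))"
      by (simp add: mult_ac)
    also have "\<dots> \<le> M * 2 powr \<alpha>"
      by (intro mult_left_mono disc_weight_times_power a z \<alpha> M)
    finally show ?thesis
      using d(2)[OF z] by (simp add: mult.commute)
  qed
  have d0: "deriv f 0 = f1 0"
    by (rule d(1)) auto
  show "f \<in> zygmund_space \<alpha>"
    by (rule zygmund_spaceI(1)[OF hol _ le]) (use M in auto)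
  show "zygmund_norm \<alpha> f \<le> ennreal (cmod (f 0) + cmod (f1 0) + 2 powr \<alpha> * M)"
    using zygmund_spaceI(2)[OF hol _ le] M d0 by simp
qed

lemma kernel_in_zygmund_space:
  assumes "0 < \<alpha>"
  obtains N where "0 \<le> N" "\<And>a. a \<in> unit_disc \<Longrightarrow> disc_kernel (\<alpha> - 2) a \<in> zygmund_space \<alpha>"
    "\<And>a. a \<in> unit_disc \<Longrightarrow> zygmund_norm \<alpha> (disc_kernel (\<alpha> - 2) a) \<le> ennreal N"
proof -
  define c where "c = disc_kernel_coeff (\<alpha> - 2)"
  have c: "0 \<le> c"
    by (simp add: c_def disc_kernel_coeff_nonneg)
  define M where "M = c * \<bar>\<alpha> - 1\<bar>"
  have M: "0 \<le> M"
    using c by (simp add: M_def)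
  define N where "N = 1 + c + 2 powr \<alpha> * M"
  have *: "disc_kernel (\<alpha> - 2) a \<in> zygmund_space \<alpha> \<and> zygmund_norm \<alpha> (disc_kernel (\<alpha> - 2) a) \<le> ennreal N"
    if a: "a \<in> unit_disc" for a
  proof -
    have a1: "cmod a \<le> 1" "(cmod a)\<^sup>2 \<le> 1"
      using a by (auto simp: power_le_one)
    have bound: "cmod (of_real (disc_kernel_coeff (\<alpha> - 2) * (\<alpha> - 2 + 1)) * (cnj a)\<^sup>2
          * (1 - cnj a * z) powr (- of_real (\<alpha> - 2 + 2)))
        \<le> M * cmod (1 - cnj a * z) powr (- \<alpha>)" for z
    proof -
      have "(cmod a)\<^sup>2 * (M * cmod (1 - cnj a * z) powr (- \<alpha>))
          \<le> 1 * (M * cmod (1 - cnj a * z) powr (- \<alpha>))"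
        using a1 M by (intro mult_right_mono) auto
      moreover have "cmod (of_real \<alpha> - 1) = \<bar>\<alpha> - 1\<bar>"
        by (metis norm_of_real of_real_1 of_real_diff)
      ultimately show ?thesis
        using c by (simp add: norm_mult norm_power norm_powr_real_powr' M_def c_def abs_mult mult_ac)
    qed
    note t = zygmund_test_functionI[OF a assms M disc_kernel_deriv[OF a] bound]
    have "cmod a * c \<le> 1 * c"
      using a1 c by (intro mult_right_mono) auto
    then have "cmod (disc_kernel (\<alpha> - 2) a 0) +
        cmod (of_real (disc_kernel_coeff (\<alpha> - 2)) * cnj a * (1 - cnj a * 0) powr (- of_real (\<alpha> - 2 + 1)))
        + 2 powr \<alpha> * M \<le> N"
      using disc_kernel_at_zero[of "\<alpha> - 2" a] c by (simp add: N_def norm_mult c_def mult.commute)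
    then show ?thesis
      using t by (meson ennreal_leI order_trans)
  qed
  have "0 \<le> N"
    using c M by (simp add: N_def)
  then show ?thesis
    using * that by blast
qed

text \<open>
  In \<open>((z - a) k)'' = 2 k' + (z - a) k''\<close>, where \<open>k\<close> is the kernel of order \<open>\<alpha> - 1\<close>, the term \<open>k'\<close> is of
  order \<open>\<alpha>\<close> and \<open>k''\<close> of order \<open>\<alpha> + 1\<close>; the factor \<open>z - a\<close> brings the latter back to \<open>\<alpha>\<close>. Thus the family
  is bounded in the space of index \<open>\<alpha>\<close>, and it isolates point values of the derivative because its
  members vanish at \<open>a\<close>.
\<close>

lemma vanishing_kernel_in_zygmund_space:
  assumes "0 < \<alpha>"
  obtains N where "0 \<le> N"
    "\<And>a. a \<in> unit_disc \<Longrightarrow> (\<lambda>z. (z - a) * disc_kernel (\<alpha> - 1) a z) \<in> zygmund_space \<alpha>"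
    "\<And>a. a \<in> unit_disc \<Longrightarrow> zygmund_norm \<alpha> (\<lambda>z. (z - a) * disc_kernel (\<alpha> - 1) a z) \<le> ennreal N"
    "\<And>a. a \<in> unit_disc \<Longrightarrow> deriv (\<lambda>z. (z - a) * disc_kernel (\<alpha> - 1) a z) a
        = of_real (growth (\<alpha> - 1) (1 - (cmod a)\<^sup>2))"
proof -
  define c where "c = disc_kernel_coeff (\<alpha> - 1)"
  have c: "0 \<le> c"
    by (simp add: c_def disc_kernel_coeff_nonneg)
  define M where "M = c * (2 + \<alpha>)"
  have M: "0 \<le> M"
    using c assms by (simp add: M_def)
  define N where "N = 1 + (1 + c) + 2 powr \<alpha> * M"
  have *: "(\<lambda>z. (z - a) * disc_kernel (\<alpha> - 1) a z) \<in> zygmund_space \<alpha> \<and>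
      zygmund_norm \<alpha> (\<lambda>z. (z - a) * disc_kernel (\<alpha> - 1) a z) \<le> ennreal N \<and>
      deriv (\<lambda>z. (z - a) * disc_kernel (\<alpha> - 1) a z) a = of_real (growth (\<alpha> - 1) (1 - (cmod a)\<^sup>2))"
    if a: "a \<in> unit_disc" for a
  proof -
    define k where "k = disc_kernel (\<alpha> - 1) a"
    define k1 where "k1 = (\<lambda>z. of_real c * cnj a * (1 - cnj a * z) powr (- of_real \<alpha>))"
    define k2 where
      "k2 = (\<lambda>z. of_real (c * \<alpha>) * (cnj a)\<^sup>2 * (1 - cnj a * z) powr (- of_real (\<alpha> + 1)))"
    have dk: "(k has_field_derivative k1 z) (at z)" "(k1 has_field_derivative k2 z) (at z)"
      if "z \<in> unit_disc" for z
      using disc_kernel_deriv[OF a that, of "\<alpha> - 1"] by (simp_all add: k_def k1_def k2_def c_def add.commute)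
    define f1 where "f1 = (\<lambda>z. k z + (z - a) * k1 z)"
    define f2 where "f2 = (\<lambda>z. 2 * k1 z + (z - a) * k2 z)"
    have d1: "((\<lambda>z. (z - a) * k z) has_field_derivative f1 z) (at z)" if "z \<in> unit_disc" for z
      unfolding f1_def by (auto intro!: derivative_eq_intros dk that)
    have d2: "(f1 has_field_derivative f2 z) (at z)" if "z \<in> unit_disc" for z
      unfolding f1_def f2_def by (auto intro!: derivative_eq_intros dk that)
    have a1: "cmod a \<le> 1" "(cmod a)\<^sup>2 \<le> 1"
      using a by (auto simp: power_le_one)
    have bound: "cmod (f2 z) \<le> M * cmod (1 - cnj a * z) powr (- \<alpha>)" if z: "z \<in> unit_disc" for z
    proof -
      note d = disc_denominator[OF a z]
      define p where "p = cmod (1 - cnj a * z) powr (- \<alpha>)"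
      have p: "0 \<le> p"
        by (simp add: p_def)
      have pp: "cmod (1 - cnj a * z) powr (- (\<alpha> + 1)) = p / cmod (1 - cnj a * z)"
        using d(3) by (simp add: p_def powr_diff)
      have n1: "cmod (k1 z) \<le> c * p"
      proof -
        have "cmod a * (c * p) \<le> 1 * (c * p)"
          using a1 c p by (intro mult_right_mono) auto
        then show ?thesis
          using c by (simp add: k1_def norm_mult norm_powr_real_powr' p_def mult_ac)
      qed
      have n2: "cmod (k2 z) \<le> c * \<alpha> * p / cmod (1 - cnj a * z)"
      proof -
        have "(cmod a)\<^sup>2 * (c * \<alpha> * p / cmod (1 - cnj a * z)) \<le> 1 * (c * \<alpha> * p / cmod (1 - cnj a * z))"
          using a1 c p assms by (intro mult_right_mono) auto
        moreover have "cmod (k2 z) = c * \<alpha> * (cmod a)\<^sup>2 * cmod (1 - cnj a * z) powr (- (\<alpha> + 1))"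
          using c assms
          by (simp add: k2_def norm_mult norm_power norm_powr_real_powr')
        ultimately show ?thesis
          unfolding pp by (simp add: mult_ac)
      qed
      have "cmod (f2 z) \<le> 2 * cmod (k1 z) + cmod (z - a) * cmod (k2 z)"
        unfolding f2_def using norm_triangle_ineq[of "2 * k1 z" "(z - a) * k2 z"] by (simp add: norm_mult)
      also have "\<dots> \<le> 2 * (c * p)
          + cmod (1 - cnj a * z) * (c * \<alpha> * p / cmod (1 - cnj a * z))"
        using n1 n2 d by (intro add_mono mult_mono) auto
      also have "\<dots> = M * p"
        using d(3) by (simp add: M_def algebra_simps)
      finally show ?thesis
        by (simp add: p_def)
    qed
    note t = zygmund_test_functionI[OF a assms M d1 d2 bound]
    have f0: "cmod ((0 - a) * k 0) \<le> 1"
      using a1 disc_kernel_at_zero[of "\<alpha> - 1" a] mult_mono[of "cmod a" 1 "cmod (k 0)" 1]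
      by (simp add: norm_mult k_def)
    have "cmod a * (cmod a * c) \<le> 1 * (1 * c)"
      using a1 c by (intro mult_mono) auto
    then have "cmod (f1 0) \<le> 1 + c"
      using norm_triangle_ineq4[of "k 0" "a * k1 0"] disc_kernel_at_zero[of "\<alpha> - 1" a] c
      by (simp add: f1_def k1_def norm_mult mult_ac k_def)
    then have "cmod ((0 - a) * k 0) + cmod (f1 0) + 2 powr \<alpha> * M \<le> N"
      using f0 by (simp add: N_def)
    then have "zygmund_norm \<alpha> (\<lambda>z. (z - a) * k z) \<le> ennreal N"
      using t(2) by (meson ennreal_leI order_trans)
    moreover have "deriv (\<lambda>z. (z - a) * k z) a = f1 a"
      using d1[OF a] by (rule DERIV_imp_deriv)
    ultimately show ?thesis
      using t(1) disc_kernel_at_centre[OF a, of "\<alpha> - 1"] by (simp add: k_def f1_def)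
  qed
  have "0 \<le> N"
    using c M by (simp add: N_def)
  then show ?thesis
    using * that by blast
qed

section \<open>Boundedness of the operator\<close>

lemma disc_self_mapD:
  assumes "disc_self_map \<phi>" "z \<in> unit_disc"
  shows "\<phi> z \<in> unit_disc" "0 < 1 - (cmod (\<phi> z))\<^sup>2" "1 - (cmod (\<phi> z))\<^sup>2 \<le> 1"
proof -
  show mem: "\<phi> z \<in> unit_disc"
    using assms unfolding disc_self_map_def by blast
  show "0 < 1 - (cmod (\<phi> z))\<^sup>2" "1 - (cmod (\<phi> z))\<^sup>2 \<le> 1"
    using disc_weight_bounds[OF mem] .
qed

lemma UC_derivatives:
  assumes f: "f holomorphic_on unit_disc" and \<phi>: "disc_self_map \<phi>" and g: "g holomorphic_on unit_disc"
  shows "UC g \<phi> f holomorphic_on unit_disc" "UC g \<phi> f 0 = 0"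
    and "z \<in> unit_disc \<Longrightarrow> deriv (UC g \<phi> f) z = f (\<phi> z) * deriv g z"
    and "z \<in> unit_disc \<Longrightarrow> deriv (deriv (UC g \<phi> f)) z =
      deriv f (\<phi> z) * (deriv g z * deriv \<phi> z) + f (\<phi> z) * deriv (deriv g) z"
proof -
  define h where "h = (\<lambda>z. f (\<phi> z) * deriv g z)"
  have \<phi>h: "\<phi> holomorphic_on unit_disc" "\<phi> ` unit_disc \<subseteq> unit_disc"
    using \<phi> by (auto simp: disc_self_map_def)
  have "h holomorphic_on unit_disc"
    unfolding h_def using holomorphic_on_compose_gen[OF \<phi>h(1) f \<phi>h(2)] g
    by (auto intro!: holomorphic_intros simp: o_def)
  then obtain P where P: "\<And>x. x \<in> unit_disc \<Longrightarrow> (P has_field_derivative h x) (at x within unit_disc)"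
    using holomorphic_convex_primitive'[of unit_disc h] by auto
  have UC: "UC g \<phi> f z = P z - P 0" if z: "z \<in> unit_disc" for z
  proof -
    have "path_image (linepath 0 z) \<subseteq> unit_disc"
      using z by (simp add: closed_segment_subset)
    then have "(h has_contour_integral (P z - P 0)) (linepath 0 z)"
      using contour_integral_primitive[OF P, of "linepath 0 z"] by simp
    then show ?thesis
      unfolding UC_def h_def by (rule contour_integral_unique)
  qed
  show "UC g \<phi> f 0 = 0"
    by (simp add: UC_def)
  have d1: "(UC g \<phi> f has_field_derivative h z) (at z)" if z: "z \<in> unit_disc" for z
  proof (rule has_field_derivative_transform_within_open[of "\<lambda>z. P z - P 0" _ _ unit_disc])
    show "((\<lambda>z. P z - P 0) has_field_derivative h z) (at z)"
      using DERIV_diff[OF P[OF z] DERIV_const, of "P 0"] z at_within_open[OF z] by simp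
  qed (use z UC in auto)
  have d2: "(h has_field_derivative
      deriv f (\<phi> z) * (deriv g z * deriv \<phi> z) + f (\<phi> z) * deriv (deriv g) z) (at z)"
    if z: "z \<in> unit_disc" for z
  proof -
    have "(f has_field_derivative deriv f (\<phi> z)) (at (\<phi> z))"
      using holomorphic_derivI[OF f _ disc_self_mapD(1)[OF \<phi> z]] by simp
    moreover have "(\<phi> has_field_derivative deriv \<phi> z) (at z)"
      using holomorphic_derivI[OF \<phi>h(1) _ z] by simp
    ultimately have "((\<lambda>z. f (\<phi> z)) has_field_derivative deriv f (\<phi> z) * deriv \<phi> z) (at z)"
      by (rule DERIV_chain2)
    moreover have "(deriv g has_field_derivative deriv (deriv g) z) (at z)"
      using holomorphic_derivI[OF holomorphic_deriv[OF g] _ z] by simp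
    ultimately show ?thesis
      unfolding h_def by (auto intro!: derivative_eq_intros simp: mult_ac)
  qed
  show "UC g \<phi> f holomorphic_on unit_disc"
    unfolding holomorphic_on_open[OF open_ball] using d1 by blast
  note d = deriv_deriv_on_open[where S = unit_disc, OF open_ball _ d1 d2]
  show "deriv (UC g \<phi> f) z = f (\<phi> z) * deriv g z" if "z \<in> unit_disc"
    using d(1)[OF that] by (simp add: h_def)
  show "deriv (deriv (UC g \<phi> f)) z =
      deriv f (\<phi> z) * (deriv g z * deriv \<phi> z) + f (\<phi> z) * deriv (deriv g) z" if "z \<in> unit_disc"
    using d(2)[OF that] .
qed

definition growth_bounded :: "real \<Rightarrow> real \<Rightarrow> (complex \<Rightarrow> complex) \<Rightarrow> (complex \<Rightarrow> complex) \<Rightarrow> bool" where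
  "growth_bounded \<beta> s \<phi> h \<longleftrightarrow> (\<exists>M\<ge>0. \<forall>z\<in>unit_disc.
     (1 - (cmod z)\<^sup>2) powr \<beta> * growth s (1 - (cmod (\<phi> z))\<^sup>2) * cmod (h z) \<le> M)"

text \<open>
  In \<open>(Tf)'' = (f' \<circ> \<phi>) u + (f \<circ> \<phi>) w\<close> the factors \<open>f' \<circ> \<phi>\<close> and \<open>f \<circ> \<phi>\<close> are at most \<open>C \<parallel>f\<parallel>\<close> times
  the growth functions in the hypotheses. The remaining part \<open>|(Tf)' 0| = |f (\<phi> 0) g' 0|\<close> of the norm is a
  point evaluation, hence also bounded.
\<close>

lemma bounded_UC_if_growth_bounded:
  assumes \<alpha>: "0 < \<alpha>" and \<phi>: "disc_self_map \<phi>" and g: "g holomorphic_on unit_disc"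
    and u: "growth_bounded \<beta> (\<alpha> - 1) \<phi> (\<lambda>z. deriv g z * deriv \<phi> z)"
    and w: "growth_bounded \<beta> (\<alpha> - 2) \<phi> (deriv (deriv g))"
  shows "bounded_zygmund_operator \<alpha> \<beta> (UC g \<phi>)"
proof -
  obtain C where C: "0 < C"
    "\<And>f N z. \<lbrakk>f \<in> zygmund_space \<alpha>; zygmund_norm \<alpha> f \<le> ennreal N; 0 \<le> N; z \<in> unit_disc\<rbrakk> \<Longrightarrow>
      cmod (deriv f z) \<le> C * N * growth (\<alpha> - 1) (1 - (cmod z)\<^sup>2)"
    "\<And>f N z. \<lbrakk>f \<in> zygmund_space \<alpha>; zygmund_norm \<alpha> f \<le> ennreal N; 0 \<le> N; z \<in> unit_disc\<rbrakk> \<Longrightarrow>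
      cmod (f z) \<le> C * N * growth (\<alpha> - 2) (1 - (cmod z)\<^sup>2)"
    using zygmund_space_growth[OF \<alpha>] by blast
  obtain M1 where M1: "0 \<le> M1" "\<And>z. z \<in> unit_disc \<Longrightarrow> (1 - (cmod z)\<^sup>2) powr \<beta>
      * growth (\<alpha> - 1) (1 - (cmod (\<phi> z))\<^sup>2) * cmod (deriv g z * deriv \<phi> z) \<le> M1"
    using u by (auto simp: growth_bounded_def)
  obtain M2 where M2: "0 \<le> M2" "\<And>z. z \<in> unit_disc \<Longrightarrow> (1 - (cmod z)\<^sup>2) powr \<beta>
      * growth (\<alpha> - 2) (1 - (cmod (\<phi> z))\<^sup>2) * cmod (deriv (deriv g) z) \<le> M2"
    using w by (auto simp: growth_bounded_def)
  have zero: "0 \<in> unit_disc"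
    by simp
  define M0 where "M0 = growth (\<alpha> - 2) (1 - (cmod (\<phi> 0))\<^sup>2) * cmod (deriv g 0)"
  have M0: "0 \<le> M0"
    using growth_nonneg[OF disc_self_mapD(2,3)[OF \<phi> zero]] by (simp add: M0_def)
  define B where "B = C * (M0 + (M1 + M2))"
  have B: "0 \<le> B"
    using C(1) M0 M1(1) M2(1) by (simp add: B_def)
  have "UC g \<phi> f \<in> zygmund_space \<beta> \<and> zygmund_norm \<beta> (UC g \<phi> f) \<le> ennreal B * zygmund_norm \<alpha> f"
    if f: "f \<in> zygmund_space \<alpha>" for f
  proof -
    obtain N where N: "0 \<le> N" "zygmund_norm \<alpha> f = ennreal N"
      using zygmund_spaceE[OF f] by metis
    have fh: "f holomorphic_on unit_disc"
      using f by (simp add: zygmund_space_def)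
    note UC = UC_derivatives[OF fh \<phi> g]
    have second: "(1 - (cmod z)\<^sup>2) powr \<beta> * cmod (deriv (deriv (UC g \<phi> f)) z) \<le> C * N * (M1 + M2)"
      if z: "z \<in> unit_disc" for z
    proof -
      define v where "v = (1 - (cmod z)\<^sup>2) powr \<beta>"
      define p where "p = cmod (deriv g z * deriv \<phi> z)"
      define q where "q = cmod (deriv (deriv g) z)"
      have nn: "0 \<le> v" "0 \<le> p" "0 \<le> q"
        by (auto simp: v_def p_def q_def)
      note \<phi>z = disc_self_mapD(1)[OF \<phi> z]
      have "cmod (deriv (deriv (UC g \<phi> f)) z) \<le> cmod (deriv f (\<phi> z)) * p + cmod (f (\<phi> z)) * q"
        unfolding UC(4)[OF z] p_def q_def norm_mult[symmetric] by (rule norm_triangle_ineq)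
      also have "\<dots> \<le> C * N * growth (\<alpha> - 1) (1 - (cmod (\<phi> z))\<^sup>2) * p
          + C * N * growth (\<alpha> - 2) (1 - (cmod (\<phi> z))\<^sup>2) * q"
        using C(2)[OF f _ N(1) \<phi>z] C(3)[OF f _ N(1) \<phi>z] N(2) nn
        by (intro add_mono mult_right_mono) auto
      finally have "v * cmod (deriv (deriv (UC g \<phi> f)) z)
          \<le> v * (C * N * growth (\<alpha> - 1) (1 - (cmod (\<phi> z))\<^sup>2) * p
          + C * N * growth (\<alpha> - 2) (1 - (cmod (\<phi> z))\<^sup>2) * q)"
        using nn by (intro mult_left_mono)
      also have "\<dots> = C * N * (v * growth (\<alpha> - 1) (1 - (cmod (\<phi> z))\<^sup>2) * p
          + v * growth (\<alpha> - 2) (1 - (cmod (\<phi> z))\<^sup>2) * q)"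
        by (simp add: algebra_simps)
      also have "\<dots> \<le> C * N * (M1 + M2)"
        using M1(2)[OF z] M2(2)[OF z] C(1) N(1)
        by (intro mult_left_mono add_mono) (auto simp: v_def p_def q_def)
      finally show ?thesis
        by (simp add: v_def)
    qed
    have nn: "0 \<le> C * N * (M1 + M2)"
      using C(1) N(1) M1(1) M2(1) by simp
    have "cmod (deriv (UC g \<phi> f) 0) = cmod (f (\<phi> 0)) * cmod (deriv g 0)"
      unfolding UC(3)[OF zero] by (rule norm_mult)
    also have "\<dots> \<le> C * N * growth (\<alpha> - 2) (1 - (cmod (\<phi> 0))\<^sup>2) * cmod (deriv g 0)"
      using C(3)[OF f _ N(1) disc_self_mapD(1)[OF \<phi> zero]] N(2) by (intro mult_right_mono) auto
    finally have "cmod (UC g \<phi> f 0) + cmod (deriv (UC g \<phi> f) 0) + C * N * (M1 + M2) \<le> B * N"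
      unfolding UC(2) by (simp add: B_def M0_def algebra_simps)
    then have "zygmund_norm \<beta> (UC g \<phi> f) \<le> ennreal (B * N)"
      using zygmund_spaceI(2)[OF UC(1) nn second] by (meson ennreal_leI order_trans)
    then show ?thesis
      using zygmund_spaceI(1)[OF UC(1) nn second] N B by (simp add: ennreal_mult)
  qed
  then show ?thesis
    unfolding bounded_zygmund_operator_def using B by blast
qed

text \<open>
  For each \<open>z\<close> the test functions are centred at \<open>a = \<phi> z\<close>. The family vanishing at \<open>a\<close> removes \<open>w\<close> from
  \<open>(Tf)'' z\<close> and yields the bound on \<open>u\<close>. For the other family the term with \<open>u\<close> is estimated by this
  bound and the growth of \<open>f'\<close>, which leaves the bound on \<open>w\<close>.
\<close>

lemma growth_bounded_if_bounded_UC: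
  assumes \<alpha>: "0 < \<alpha>" and \<phi>: "disc_self_map \<phi>" and g: "g holomorphic_on unit_disc"
    and bdd: "bounded_zygmund_operator \<alpha> \<beta> (UC g \<phi>)"
  shows "growth_bounded \<beta> (\<alpha> - 1) \<phi> (\<lambda>z. deriv g z * deriv \<phi> z)"
    and "growth_bounded \<beta> (\<alpha> - 2) \<phi> (deriv (deriv g))"
proof -
  obtain B where B: "0 \<le> B" "\<And>f. f \<in> zygmund_space \<alpha> \<Longrightarrow>
      zygmund_norm \<beta> (UC g \<phi> f) \<le> ennreal B * zygmund_norm \<alpha> f"
    using bdd unfolding bounded_zygmund_operator_def by blast
  have test: "(1 - (cmod z)\<^sup>2) powr \<beta> *
      cmod (deriv f (\<phi> z) * (deriv g z * deriv \<phi> z) + f (\<phi> z) * deriv (deriv g) z) \<le> B * N"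
    if f: "f \<in> zygmund_space \<alpha>" "zygmund_norm \<alpha> f \<le> ennreal N" "0 \<le> N" and z: "z \<in> unit_disc"
    for f N z
  proof -
    have fh: "f holomorphic_on unit_disc"
      using f by (simp add: zygmund_space_def)
    have "weighted_norm \<beta> (deriv (deriv (UC g \<phi> f))) \<le> zygmund_norm \<beta> (UC g \<phi> f)"
      unfolding zygmund_norm_def by (rule add_increasing) auto
    also have "\<dots> \<le> ennreal B * zygmund_norm \<alpha> f"
      by (rule B(2)[OF f(1)])
    also have "\<dots> \<le> ennreal B * ennreal N"
      using f(2) by (rule mult_left_mono) simp
    finally have le: "weighted_norm \<beta> (deriv (deriv (UC g \<phi> f))) \<le> ennreal (B * N)"
      using B(1) f(3) by (simp add: ennreal_mult)
    have "0 \<le> B * N"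
      using B(1) f(3) by simp
    note bspec[OF iffD1[OF weighted_norm_le_iff[OF this] le] z]
    then show ?thesis
      by (simp only: UC_derivatives(4)[OF fh \<phi> g z])
  qed
  obtain N1 where N1: "0 \<le> N1"
    "\<And>a. a \<in> unit_disc \<Longrightarrow> (\<lambda>z. (z - a) * disc_kernel (\<alpha> - 1) a z) \<in> zygmund_space \<alpha>"
    "\<And>a. a \<in> unit_disc \<Longrightarrow> zygmund_norm \<alpha> (\<lambda>z. (z - a) * disc_kernel (\<alpha> - 1) a z) \<le> ennreal N1"
    "\<And>a. a \<in> unit_disc \<Longrightarrow> deriv (\<lambda>z. (z - a) * disc_kernel (\<alpha> - 1) a z) a
        = of_real (growth (\<alpha> - 1) (1 - (cmod a)\<^sup>2))"
    by (rule vanishing_kernel_in_zygmund_space[OF \<alpha>]) (rule that)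
  have u: "(1 - (cmod z)\<^sup>2) powr \<beta> * growth (\<alpha> - 1) (1 - (cmod (\<phi> z))\<^sup>2) * cmod (deriv g z * deriv \<phi> z)
      \<le> B * N1" if z: "z \<in> unit_disc" for z
  proof -
    note \<phi>z = disc_self_mapD[OF \<phi> z]
    show ?thesis
      using test[OF N1(2)[OF \<phi>z(1)] N1(3)[OF \<phi>z(1)] N1(1) z]
      unfolding N1(4)[OF \<phi>z(1)] using growth_nonneg[OF \<phi>z(2,3)]
      by (simp add: norm_mult mult_ac)
  qed
  then show "growth_bounded \<beta> (\<alpha> - 1) \<phi> (\<lambda>z. deriv g z * deriv \<phi> z)"
    unfolding growth_bounded_def using B(1) N1(1) by (intro exI[of _ "B * N1"]) auto
  obtain N2 where N2: "0 \<le> N2" "\<And>a. a \<in> unit_disc \<Longrightarrow> disc_kernel (\<alpha> - 2) a \<in> zygmund_space \<alpha>"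
    "\<And>a. a \<in> unit_disc \<Longrightarrow> zygmund_norm \<alpha> (disc_kernel (\<alpha> - 2) a) \<le> ennreal N2"
    by (rule kernel_in_zygmund_space[OF \<alpha>]) (rule that)
  obtain C where C: "0 < C"
    "\<And>f N z. \<lbrakk>f \<in> zygmund_space \<alpha>; zygmund_norm \<alpha> f \<le> ennreal N; 0 \<le> N; z \<in> unit_disc\<rbrakk> \<Longrightarrow>
      cmod (deriv f z) \<le> C * N * growth (\<alpha> - 1) (1 - (cmod z)\<^sup>2)"
    by (rule zygmund_space_growth[OF \<alpha>]) (rule that)
  have "(1 - (cmod z)\<^sup>2) powr \<beta> * growth (\<alpha> - 2) (1 - (cmod (\<phi> z))\<^sup>2) * cmod (deriv (deriv g) z)
      \<le> B * N2 + C * N2 * (B * N1)" if z: "z \<in> unit_disc" for z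
  proof -
    note \<phi>z = disc_self_mapD[OF \<phi> z]
    define v where "v = (1 - (cmod z)\<^sup>2) powr \<beta>"
    define f where "f = disc_kernel (\<alpha> - 2) (\<phi> z)"
    define x where "x = deriv f (\<phi> z) * (deriv g z * deriv \<phi> z)"
    define y where "y = f (\<phi> z) * deriv (deriv g) z"
    note f = N2(2,3)[OF \<phi>z(1)] N2(1)
    have v: "0 \<le> v"
      by (simp add: v_def)
    have "v * cmod y = v * growth (\<alpha> - 2) (1 - (cmod (\<phi> z))\<^sup>2) * cmod (deriv (deriv g) z)"
      using growth_nonneg[OF \<phi>z(2,3), of "\<alpha> - 2"] disc_kernel_at_centre[OF \<phi>z(1), of "\<alpha> - 2"]
      by (simp add: y_def f_def norm_mult)
    moreover have "v * cmod (x + y) \<le> B * N2"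
      using test[OF f z] by (simp add: v_def x_def y_def f_def)
    moreover have "v * cmod x \<le> C * N2 * (B * N1)"
    proof -
      have "cmod (deriv f (\<phi> z)) \<le> C * N2 * growth (\<alpha> - 1) (1 - (cmod (\<phi> z))\<^sup>2)"
        unfolding f_def by (rule C(2)[OF f \<phi>z(1)])
      then have "cmod (deriv f (\<phi> z)) * (v * cmod (deriv g z * deriv \<phi> z))
          \<le> C * N2 * growth (\<alpha> - 1) (1 - (cmod (\<phi> z))\<^sup>2) * (v * cmod (deriv g z * deriv \<phi> z))"
        using v by (intro mult_right_mono) auto
      also have "\<dots> = C * N2 *
          (v * growth (\<alpha> - 1) (1 - (cmod (\<phi> z))\<^sup>2) * cmod (deriv g z * deriv \<phi> z))"
        by (simp add: mult_ac)
      also have "\<dots> \<le> C * N2 * (B * N1)"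
        using u[OF z] C(1) N2(1) by (intro mult_left_mono) (auto simp: v_def)
      finally show ?thesis
        by (simp add: x_def norm_mult mult_ac)
    qed
    moreover have "v * cmod y \<le> v * cmod (x + y) + v * cmod x"
      using mult_left_mono[OF norm_triangle_ineq4[of "x + y" x] v] by (simp add: algebra_simps)
    ultimately show ?thesis
      unfolding v_def[symmetric] by linarith
  qed
  then show "growth_bounded \<beta> (\<alpha> - 2) \<phi> (deriv (deriv g))"
    unfolding growth_bounded_def using B(1) N1(1) N2(1) C(1)
    by (intro exI[of _ "B * N2 + C * N2 * (B * N1)"]) auto
qed

lemma bounded_UC_iff_growth_bounded:
  assumes "0 < \<alpha>" "disc_self_map \<phi>" "g holomorphic_on unit_disc"
  shows "bounded_zygmund_operator \<alpha> \<beta> (UC g \<phi>) \<longleftrightarrow>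
    growth_bounded \<beta> (\<alpha> - 1) \<phi> (\<lambda>z. deriv g z * deriv \<phi> z) \<and>
    growth_bounded \<beta> (\<alpha> - 2) \<phi> (deriv (deriv g))"
  using bounded_UC_if_growth_bounded[OF assms] growth_bounded_if_bounded_UC[OF assms] by blast

section \<open>Reformulation by powers of the symbol\<close>

lemma H_infinity_iff_growth_bounded:
  assumes "s < 0" "h holomorphic_on unit_disc"
  shows "h \<in> H_infinity \<beta> \<longleftrightarrow> growth_bounded \<beta> s \<phi> h"
  using assms unfolding H_infinity_def weighted_norm_def ennreal_SUP_finite_iff growth_bounded_def
  by (simp add: growth_def)

text \<open>
  The pointwise comparison of \<open>growth s (1 - r\<^sup>2)\<close> with \<open>sup\<^sub>n a\<^sub>n r ^ n\<close>, taken at \<open>r = |\<phi> z|\<close> and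
  multiplied by \<open>v\<^sub>\<beta> |h|\<close>, survives the supremum over \<open>z\<close>. Comparability with these constants therefore
  always holds, and only finiteness carries information.
\<close>

lemma comparable_finite_iff_growth_bounded:
  assumes K: "0 < K" and a: "\<And>n. 0 \<le> a n"
    and up: "\<And>r n. 0 \<le> r \<Longrightarrow> r < 1 \<Longrightarrow> a n * r ^ n \<le> K * growth s (1 - r\<^sup>2)"
    and low: "\<And>r. 0 \<le> r \<Longrightarrow> r < 1 \<Longrightarrow> \<exists>n. growth s (1 - r\<^sup>2) \<le> K * (a n * r ^ n)"
    and \<phi>: "disc_self_map \<phi>"
    and F: "\<And>z. z \<in> unit_disc \<Longrightarrow>
      F z = (1 - (cmod z)\<^sup>2) powr \<beta> * growth s (1 - (cmod (\<phi> z))\<^sup>2) * cmod (h z)"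
  shows "comparable_finite (1 / K) K
      (SUP n. ennreal (a n) * weighted_norm \<beta> (\<lambda>z. h z * \<phi> z ^ n))
      (SUP z\<in>unit_disc. ennreal (F z)) \<longleftrightarrow> growth_bounded \<beta> s \<phi> h"
proof -
  define X where "X = (SUP n. ennreal (a n) * weighted_norm \<beta> (\<lambda>z. h z * \<phi> z ^ n))"
  define Y where "Y = (SUP z\<in>unit_disc. ennreal (F z))"
  have r: "0 \<le> cmod (\<phi> z)" "cmod (\<phi> z) < 1" if "z \<in> unit_disc" for z
    using disc_self_mapD(1)[OF \<phi> that] by auto
  have "X \<le> ennreal K * Y"
    unfolding X_def weighted_norm_def SUP_mult_left_ennreal
  proof (intro SUP_least)
    fix n z assume z: "z \<in> unit_disc"
    define c where "c = (1 - (cmod z)\<^sup>2) powr \<beta> * cmod (h z)"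
    have "ennreal (a n) * ennreal ((1 - (cmod z)\<^sup>2) powr \<beta> * cmod (h z * \<phi> z ^ n))
        = ennreal (c * (a n * cmod (\<phi> z) ^ n))"
      using a by (simp add: c_def norm_mult norm_power mult_ac flip: ennreal_mult)
    also have "\<dots> \<le> ennreal (c * (K * growth s (1 - (cmod (\<phi> z))\<^sup>2)))"
      using up[OF r[OF z], of n] by (intro ennreal_leI mult_left_mono) (auto simp: c_def)
    also have "\<dots> = ennreal (K * F z)"
      by (simp add: F[OF z] c_def mult_ac)
    also have "\<dots> = ennreal K * ennreal (F z)"
      using K F[OF z] growth_nonneg[OF disc_self_mapD(2,3)[OF \<phi> z]] by (simp add: ennreal_mult)
    also have "\<dots> \<le> ennreal K * Y"
      unfolding Y_def by (intro mult_left_mono SUP_upper z) auto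
    finally show "ennreal (a n) * ennreal ((1 - (cmod z)\<^sup>2) powr \<beta> * cmod (h z * \<phi> z ^ n))
        \<le> ennreal K * Y" .
  qed
  moreover have "Y \<le> ennreal K * X"
    unfolding Y_def
  proof (rule SUP_least)
    fix z assume z: "z \<in> unit_disc"
    define c where "c = (1 - (cmod z)\<^sup>2) powr \<beta> * cmod (h z)"
    obtain n where n: "growth s (1 - (cmod (\<phi> z))\<^sup>2) \<le> K * (a n * cmod (\<phi> z) ^ n)"
      using low[OF r[OF z]] by blast
    have "F z = c * growth s (1 - (cmod (\<phi> z))\<^sup>2)"
      by (simp add: F[OF z] c_def)
    also have "\<dots> \<le> c * (K * (a n * cmod (\<phi> z) ^ n))"
      using n by (intro mult_left_mono) (auto simp: c_def)
    also have "\<dots> = K * (a n * ((1 - (cmod z)\<^sup>2) powr \<beta> * cmod (h z * \<phi> z ^ n)))"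
      by (simp add: c_def norm_mult norm_power)
    finally have "ennreal (F z)
        \<le> ennreal K * (ennreal (a n) * ennreal ((1 - (cmod z)\<^sup>2) powr \<beta> * cmod (h z * \<phi> z ^ n)))"
      using K a by (simp add: ennreal_leI flip: ennreal_mult)
    also have "\<dots> \<le> ennreal K * (ennreal (a n) * weighted_norm \<beta> (\<lambda>z. h z * \<phi> z ^ n))"
      unfolding weighted_norm_def by (intro mult_left_mono SUP_upper z) auto
    also have "\<dots> \<le> ennreal K * X"
      unfolding X_def by (intro mult_left_mono SUP_upper) auto
    finally show "ennreal (F z) \<le> ennreal K * X" .
  qed
  moreover have "ennreal (1 / K) * X \<le> Y" if "X \<le> ennreal K * Y"
  proof -
    have "ennreal (1 / K) * X \<le> ennreal (1 / K) * (ennreal K * Y)"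
      using that by (intro mult_left_mono) auto
    also have "\<dots> = Y"
      using K by (simp add: mult.assoc[symmetric] flip: ennreal_mult)
    finally show ?thesis .
  qed
  moreover have "X < \<infinity>" if "X \<le> ennreal K * Y" "Y < \<infinity>"
    using that by (auto simp: ennreal_mult_less_top intro: order.strict_trans1)
  moreover have "Y < \<infinity> \<longleftrightarrow> growth_bounded \<beta> s \<phi> h"
    unfolding Y_def ennreal_SUP_finite_iff growth_bounded_def using F by simp
  ultimately show ?thesis
    unfolding comparable_finite_def X_def[symmetric] Y_def[symmetric] by blast
qed

lemma logarithmic_comparable_finite_iff:
  assumes "disc_self_map \<phi>"
  shows "comparable_finite (1 / 6) 6
      (SUP n. ennreal (ln (real n + 2)) * weighted_norm \<beta> (\<lambda>z. h z * \<phi> z ^ n))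
      (SUP z\<in>unit_disc. ennreal ((1 - (cmod z)\<^sup>2) powr \<beta> * ln (2 / (1 - (cmod (\<phi> z))\<^sup>2)) * cmod (h z)))
    \<longleftrightarrow> growth_bounded \<beta> 0 \<phi> h"
  using logarithmic_weights_match_growth assms
  by (intro comparable_finite_iff_growth_bounded) (auto simp: growth_def)

lemma polynomial_comparable_finite_iff:
  assumes "0 < s"
  obtains K where "0 < K"
    "\<And>\<phi> h \<beta>. disc_self_map \<phi> \<Longrightarrow> comparable_finite (1 / K) K
      (SUP n. ennreal ((real n + 1) powr s) * weighted_norm \<beta> (\<lambda>z. h z * \<phi> z ^ n))
      (SUP z\<in>unit_disc. ennreal ((1 - (cmod z)\<^sup>2) powr \<beta> / (1 - (cmod (\<phi> z))\<^sup>2) powr s * cmod (h z)))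
    \<longleftrightarrow> growth_bounded \<beta> s \<phi> h"
proof -
  obtain K where K: "0 < K"
    "\<And>r n. 0 \<le> r \<Longrightarrow> r < 1 \<Longrightarrow> (real n + 1) powr s * r ^ n \<le> K * growth s (1 - r\<^sup>2)"
    "\<And>r. 0 \<le> r \<Longrightarrow> r < 1 \<Longrightarrow> \<exists>n. growth s (1 - r\<^sup>2) \<le> K * ((real n + 1) powr s * r ^ n)"
    using polynomial_weights_match_growth[OF assms] by blast
  show ?thesis
    by (rule that[OF K(1)], rule comparable_finite_iff_growth_bounded[OF K(1) _ K(2,3)])
      (use assms in \<open>auto simp: growth_def powr_minus_divide\<close>)
qed

theorem theorem2p4:
  fixes \<alpha> \<beta> :: real
  assumes "0 < \<beta>"
  shows
    "(0 < \<alpha> \<and> \<alpha> < 1 \<longrightarrow>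
      (\<forall>\<phi> g. disc_self_map \<phi> \<and> g holomorphic_on unit_disc \<longrightarrow>
         (bounded_zygmund_operator \<alpha> \<beta> (UC g \<phi>) \<longleftrightarrow>
            (\<lambda>z. deriv g z * deriv \<phi> z) \<in> H_infinity \<beta> \<and>
            deriv (deriv g) \<in> H_infinity \<beta>))) \<and>
     (\<alpha> = 1 \<longrightarrow>
      (\<exists>C1 C2. 0 < C1 \<and> 0 < C2 \<and>
       (\<forall>\<phi> g. disc_self_map \<phi> \<and> g holomorphic_on unit_disc \<longrightarrow>
         (bounded_zygmund_operator \<alpha> \<beta> (UC g \<phi>) \<longleftrightarrow>
            deriv (deriv g) \<in> H_infinity \<beta> \<and>
            comparable_finite C1 C2
              (SUP n. ennreal (ln (real n + 2)) *
                 weighted_norm \<beta> (\<lambda>z. deriv g z * deriv \<phi> z * \<phi> z ^ n))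
              (SUP z\<in>unit_disc. ennreal ((1 - (cmod z)\<^sup>2) powr \<beta> * ln (2 / (1 - (cmod (\<phi> z))\<^sup>2)) *
                 cmod (deriv g z * deriv \<phi> z))))))) \<and>
     (1 < \<alpha> \<and> \<alpha> < 2 \<longrightarrow>
      (\<exists>C1 C2. 0 < C1 \<and> 0 < C2 \<and>
       (\<forall>\<phi> g. disc_self_map \<phi> \<and> g holomorphic_on unit_disc \<longrightarrow>
         (bounded_zygmund_operator \<alpha> \<beta> (UC g \<phi>) \<longleftrightarrow>
            deriv (deriv g) \<in> H_infinity \<beta> \<and>
            comparable_finite C1 C2
              (SUP n. ennreal ((real n + 1) powr (\<alpha> - 1)) *
                 weighted_norm \<beta> (\<lambda>z. deriv g z * deriv \<phi> z * \<phi> z ^ n))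
              (SUP z\<in>unit_disc. ennreal ((1 - (cmod z)\<^sup>2) powr \<beta> / (1 - (cmod (\<phi> z))\<^sup>2) powr (\<alpha> - 1) *
                 cmod (deriv g z * deriv \<phi> z))))))) \<and>
     (\<alpha> = 2 \<longrightarrow>
      (\<exists>C1 C2 C3 C4. 0 < C1 \<and> 0 < C2 \<and> 0 < C3 \<and> 0 < C4 \<and>
       (\<forall>\<phi> g. disc_self_map \<phi> \<and> g holomorphic_on unit_disc \<longrightarrow>
         (bounded_zygmund_operator \<alpha> \<beta> (UC g \<phi>) \<longleftrightarrow>
            comparable_finite C1 C2
              (SUP n. ennreal (real n + 1) *
                 weighted_norm \<beta> (\<lambda>z. deriv g z * deriv \<phi> z * \<phi> z ^ n))
              (SUP z\<in>unit_disc. ennreal ((1 - (cmod z)\<^sup>2) powr \<beta> / (1 - (cmod (\<phi> z))\<^sup>2) *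
                 cmod (deriv g z * deriv \<phi> z))) \<and>
            comparable_finite C3 C4
              (SUP n. ennreal (ln (real n + 2)) *
                 weighted_norm \<beta> (\<lambda>z. deriv (deriv g) z * \<phi> z ^ n))
              (SUP z\<in>unit_disc. ennreal ((1 - (cmod z)\<^sup>2) powr \<beta> * ln (2 / (1 - (cmod (\<phi> z))\<^sup>2)) *
                 cmod (deriv (deriv g) z))))))) \<and>
     (2 < \<alpha> \<longrightarrow>
      (\<exists>C1 C2 C3 C4. 0 < C1 \<and> 0 < C2 \<and> 0 < C3 \<and> 0 < C4 \<and>
       (\<forall>\<phi> g. disc_self_map \<phi> \<and> g holomorphic_on unit_disc \<longrightarrow>
         (bounded_zygmund_operator \<alpha> \<beta> (UC g \<phi>) \<longleftrightarrow>
            comparable_finite C1 C2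
              (SUP n. ennreal ((real n + 1) powr (\<alpha> - 1)) *
                 weighted_norm \<beta> (\<lambda>z. deriv g z * deriv \<phi> z * \<phi> z ^ n))
              (SUP z\<in>unit_disc. ennreal ((1 - (cmod z)\<^sup>2) powr \<beta> / (1 - (cmod (\<phi> z))\<^sup>2) powr (\<alpha> - 1) *
                 cmod (deriv g z * deriv \<phi> z))) \<and>
            comparable_finite C3 C4
              (SUP n. ennreal ((real n + 1) powr (\<alpha> - 2)) *
                 weighted_norm \<beta> (\<lambda>z. deriv (deriv g) z * \<phi> z ^ n))
              (SUP z\<in>unit_disc. ennreal ((1 - (cmod z)\<^sup>2) powr \<beta> / (1 - (cmod (\<phi> z))\<^sup>2) powr (\<alpha> - 2) *
                 cmod (deriv (deriv g) z)))))))"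
proof (intro conjI impI, goal_cases)
  have u: "(\<lambda>z. deriv g z * deriv \<phi> z) \<in> H_infinity \<beta> \<longleftrightarrow>
      growth_bounded \<beta> s \<phi> (\<lambda>z. deriv g z * deriv \<phi> z)"
    if "disc_self_map \<phi>" "g holomorphic_on unit_disc" "s < 0" for \<phi> g s
    using that by (intro H_infinity_iff_growth_bounded)
      (auto simp: disc_self_map_def intro!: holomorphic_intros)
  have w: "deriv (deriv g) \<in> H_infinity \<beta> \<longleftrightarrow> growth_bounded \<beta> s \<phi> (deriv (deriv g))"
    if "g holomorphic_on unit_disc" "s < 0" for \<phi> g s
    using that by (intro H_infinity_iff_growth_bounded) (auto intro!: holomorphic_intros)
  {
    case 1
    then have "0 < \<alpha>" "\<alpha> - 1 < 0" "\<alpha> - 2 < 0"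
      by auto
    then show ?case
      using bounded_UC_iff_growth_bounded u w by blast
  next
    case 2
    have eq: "\<alpha> - 1 = 0" "0 < \<alpha>" "\<alpha> - 2 < 0"
      using 2 by auto
    show ?case
    proof (rule exI[of _ "1 / 6"], rule exI[of _ "6"], intro conjI allI impI, goal_cases)
      case (3 \<phi> g)
      then have h: "disc_self_map \<phi>" "g holomorphic_on unit_disc"
        by auto
      show ?case
        unfolding bounded_UC_iff_growth_bounded[OF eq(2) h] w[OF h(2) eq(3), of \<phi>]
          logarithmic_comparable_finite_iff[OF h(1)] eq(1)
        by (rule conj_commute)
    qed (use 2 in auto)
  next
    case 3
    have s: "0 < \<alpha> - 1" "0 < \<alpha>" "\<alpha> - 2 < 0"
      using 3 by auto
    obtain K where K: "0 < K"
      "\<And>\<phi> h \<beta>. disc_self_map \<phi> \<Longrightarrow> comparable_finite (1 / K) K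
        (SUP n. ennreal ((real n + 1) powr (\<alpha> - 1)) * weighted_norm \<beta> (\<lambda>z. h z * \<phi> z ^ n))
        (SUP z\<in>unit_disc. ennreal ((1 - (cmod z)\<^sup>2) powr \<beta> / (1 - (cmod (\<phi> z))\<^sup>2) powr (\<alpha> - 1)
          * cmod (h z)))
        \<longleftrightarrow> growth_bounded \<beta> (\<alpha> - 1) \<phi> h"
      using polynomial_comparable_finite_iff[OF s(1)] by blast
    show ?case
    proof (rule exI[of _ "1 / K"], rule exI[of _ "K"], intro conjI allI impI, goal_cases)
      case (3 \<phi> g)
      then have h: "disc_self_map \<phi>" "g holomorphic_on unit_disc"
        by auto
      show ?case
        unfolding bounded_UC_iff_growth_bounded[OF s(2) h] w[OF h(2) s(3), of \<phi>] K(2)[OF h(1)]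
        by (rule conj_commute)
    qed (use K(1) in auto)
  next
    case 4
    have s: "(0::real) < 1" "0 < \<alpha>" "\<alpha> - 1 = 1" "\<alpha> - 2 = 0"
      using 4 by auto
    obtain K where K: "0 < K"
      "\<And>\<phi> h \<beta>. disc_self_map \<phi> \<Longrightarrow> comparable_finite (1 / K) K
        (SUP n. ennreal ((real n + 1) powr 1) * weighted_norm \<beta> (\<lambda>z. h z * \<phi> z ^ n))
        (SUP z\<in>unit_disc. ennreal ((1 - (cmod z)\<^sup>2) powr \<beta> / (1 - (cmod (\<phi> z))\<^sup>2) powr 1 * cmod (h z)))
        \<longleftrightarrow> growth_bounded \<beta> 1 \<phi> h"
      using polynomial_comparable_finite_iff[OF s(1)] by blast
    have K': "comparable_finite (1 / K) K
        (SUP n. ennreal (real n + 1) * weighted_norm \<beta> (\<lambda>z. h z * \<phi> z ^ n))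
        (SUP z\<in>unit_disc. ennreal ((1 - (cmod z)\<^sup>2) powr \<beta> / (1 - (cmod (\<phi> z))\<^sup>2) * cmod (h z)))
        \<longleftrightarrow> growth_bounded \<beta> 1 \<phi> h" if \<phi>: "disc_self_map \<phi>" for \<phi> h
    proof -
      have "(SUP z\<in>unit_disc. ennreal ((1 - (cmod z)\<^sup>2) powr \<beta> / (1 - (cmod (\<phi> z))\<^sup>2) * cmod (h z)))
          = (SUP z\<in>unit_disc. ennreal ((1 - (cmod z)\<^sup>2) powr \<beta> / (1 - (cmod (\<phi> z))\<^sup>2) powr 1 * cmod (h z)))"
        using disc_self_mapD(2)[OF \<phi>] by (intro SUP_cong) (simp_all add: less_imp_le)
      then show ?thesis
        using K(2)[OF \<phi>, of \<beta> h] by simp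
    qed
    show ?case
    proof (rule exI[of _ "1 / K"], rule exI[of _ "K"], rule exI[of _ "1 / 6"], rule exI[of _ "6"], intro conjI allI impI, goal_cases)
      case (5 \<phi> g)
      then have h: "disc_self_map \<phi>" "g holomorphic_on unit_disc"
        by auto
      show ?case
        unfolding bounded_UC_iff_growth_bounded[OF s(2) h] K'[OF h(1)]
          logarithmic_comparable_finite_iff[OF h(1)] s(3,4)
        by (rule refl)
    qed (use K(1) in auto)
  next
    case 5
    have s: "0 < \<alpha> - 1" "0 < \<alpha> - 2" "0 < \<alpha>"
      using 5 by auto
    obtain K1 where K1: "0 < K1"
      "\<And>\<phi> h \<beta>. disc_self_map \<phi> \<Longrightarrow> comparable_finite (1 / K1) K1
        (SUP n. ennreal ((real n + 1) powr (\<alpha> - 1)) * weighted_norm \<beta> (\<lambda>z. h z * \<phi> z ^ n))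
        (SUP z\<in>unit_disc. ennreal ((1 - (cmod z)\<^sup>2) powr \<beta> / (1 - (cmod (\<phi> z))\<^sup>2) powr (\<alpha> - 1)
          * cmod (h z)))
        \<longleftrightarrow> growth_bounded \<beta> (\<alpha> - 1) \<phi> h"
      using polynomial_comparable_finite_iff[OF s(1)] by blast
    obtain K2 where K2: "0 < K2"
      "\<And>\<phi> h \<beta>. disc_self_map \<phi> \<Longrightarrow> comparable_finite (1 / K2) K2
        (SUP n. ennreal ((real n + 1) powr (\<alpha> - 2)) * weighted_norm \<beta> (\<lambda>z. h z * \<phi> z ^ n))
        (SUP z\<in>unit_disc. ennreal ((1 - (cmod z)\<^sup>2) powr \<beta> / (1 - (cmod (\<phi> z))\<^sup>2) powr (\<alpha> - 2)
          * cmod (h z)))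
        \<longleftrightarrow> growth_bounded \<beta> (\<alpha> - 2) \<phi> h"
      using polynomial_comparable_finite_iff[OF s(2)] by blast
    show ?case
    proof (rule exI[of _ "1 / K1"], rule exI[of _ "K1"], rule exI[of _ "1 / K2"], rule exI[of _ "K2"], intro conjI allI impI, goal_cases)
      case (5 \<phi> g)
      then have h: "disc_self_map \<phi>" "g holomorphic_on unit_disc"
        by auto
      show ?case
        unfolding bounded_UC_iff_growth_bounded[OF s(3) h] K1(2)[OF h(1)] K2(2)[OF h(1)]
        by (rule refl)
    qed (use K1(1) K2(1) in auto)
  }
qed

end
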